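(* Let $p\ge3$ be a prime, let $k=mp^{s}$ with integers $m\ge1$, $s\ge0$, and suppose that $\frac{p-1}{(m,p-1)}$ is even, where $(m,p-1)$ denotes the greatest common divisor of $m$ and $p-1$. Let $\theta\in\mathcal E_p$, $\theta\neq1$, and assume $\kappa_p\ge2$. Let $X$ be the set defined in the context. If $|k|_p>|\theta-1|_p$, then the Ising mapping $f_\theta$ restricted to its Julia set $J_{f_\theta}$ is conjugate to the full shift $(\Sigma,\sigma)$ on $\kappa_p$ symbols; that is, there is a homeomorphism $h:J_{f_\theta}\to\Sigma$ with $h\circ f_\theta=\sigma\circ h$ on $J_{f_\theta}$.
   Context: $\mathbb Q_p$ is the field of $p$-adic numbers with the $p$-adic norm $|\cdot|_p$. $\mathcal E_p=\{x\in\mathbb Q_p:|x-1|_p\le1/p\}$ (for $p\ge3$). The Ising mapping is the Potts-Bethe mapping with $q=2$: $$f_\theta(x)=\left(\frac{\theta x+1}{x+\theta}\right)^k.$$ $B_r(a)=\{x\in\mathbb Q_p:|x-a|_p\le r\}$. Identify $\mathbb F_p$ with $\{0,1,\dots,p-1\}$ and let $\{\xi_1,\dots,\xi_{\kappa_p}\}$ be the set of all $\xi\in\mathbb F_p$ with $\xi^k+1\equiv0\pmod p$, so that $\kappa_p$ is the number of such $\xi$. The set $X$ is the finite union of disjoint balls $$X=\bigcup_{i=1}^{\kappa_p}B_r(x_i),\qquad r=|p(\theta-1)|_p=p^{-1}|\theta-1|_p,$$ where $x_i=-1+\eta_i(\theta-1)$ when $\xi_i+1\not\equiv0\pmod p$,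 with $\eta_i$ an integer satisfying $\eta_i(\xi_i-1)+\xi_i+1\equiv0\pmod p$, and $x_i=-1$ when $\xi_i+1\equiv0\pmod p$. The Julia set of $f_\theta:X\to\mathbb Q_p$ is $J_{f_\theta}=\bigcap_{n\ge0}f_\theta^{-n}(X)$ (the points of $X$ all of whose iterates are in $X$). $\Sigma=\{1,\dots,\kappa_p\}^{\{0,1,2,\dots\}}$ carries the product topology and $\sigma$ is the left shift. *)

theory Defs
  imports
    "HOL-Analysis.Analysis"
    "HOL-Number_Theory.Cong"
    "Berlekamp_Zassenhaus.Finite_Field"
begin

section \<open>The field of p-adic numbers\<close>

subsection \<open>The p-adic absolute value on the rationals\<close>

definition padic_abs :: "nat \<Rightarrow> rat \<Rightarrow> real" where
  "padic_abs p q = (if q = 0 then 0 else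
     real p powi (int (multiplicity (int p) (snd (quotient_of q)))
                - int (multiplicity (int p) (fst (quotient_of q)))))"

lemma padic_abs_0 [simp]: "padic_abs p 0 = 0"
  by (simp add: padic_abs_def)

lemma padic_abs_nonneg [simp]: "padic_abs p q \<ge> 0"
  by (simp add: padic_abs_def)

context
  fixes p :: nat
  assumes p: "prime p"
begin

lemma padic_abs_eq_0_iff: "padic_abs p q = 0 \<longleftrightarrow> q = 0"
  using p by (auto simp: padic_abs_def prime_gt_0_nat)

lemma padic_abs_1: "padic_abs p 1 = 1"
  by (simp add: padic_abs_def)

lemma padic_abs_divide_int:
  assumes "a \<noteq> 0" "b \<noteq> 0"
  shows "padic_abs p (of_int a / of_int b) =
    real p powi (int (multiplicity (int p) b) - int (multiplicity (int p) a))"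
proof -
  define q :: rat where "q = of_int a / of_int b"
  obtain c d where cd: "quotient_of q = (c, d)" by force
  have d: "d > 0" using quotient_of_denom_pos[OF cd] .
  have q: "q = of_int c / of_int d" using quotient_of_div[OF cd] .
  have "q \<noteq> 0" using assms by (simp add: q_def)
  then have c: "c \<noteq> 0" using q by auto
  have pe: "prime_elem (int p)" using p by auto
  have "of_int (a * d) = (of_int (c * b) :: rat)"
    using q q_def assms d by (simp add: field_simps)
  then have eq: "a * d = c * b" by (simp only: of_int_eq_iff)
  have "multiplicity (int p) a + multiplicity (int p) d = multiplicity (int p) (a * d)"
    using prime_elem_multiplicity_mult_distrib[OF pe, of a d] assms d by simp
  moreover have "multiplicity (int p) (c * b) = multiplicity (int p) c + multiplicity (int p) b"
    using prime_elem_multiplicity_mult_distrib[OF pe, of c b] assms c by simp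
  ultimately have "int (multiplicity (int p) d) - int (multiplicity (int p) c) =
      int (multiplicity (int p) b) - int (multiplicity (int p) a)"
    unfolding eq by linarith
  then show ?thesis
    unfolding q_def[symmetric] using \<open>q \<noteq> 0\<close> by (simp add: padic_abs_def cd)
qed

lemma padic_abs_mult: "padic_abs p (x * y) = padic_abs p x * padic_abs p y"
proof (cases "x = 0 \<or> y = 0")
  case False
  obtain a b where x: "quotient_of x = (a, b)" by force
  obtain c d where y: "quotient_of y = (c, d)" by force
  have b: "b > 0" and d: "d > 0" using quotient_of_denom_pos x y by auto
  have x': "x = of_int a / of_int b" and y': "y = of_int c / of_int d"
    using quotient_of_div x y by auto
  have a: "a \<noteq> 0" and c: "c \<noteq> 0" using False x' y' by auto
  have pe: "prime_elem (int p)" using p by auto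
  have xy: "x * y = of_int (a * c) / of_int (b * d)" by (simp add: x' y')
  have p0: "real p \<noteq> 0" using p by (simp add: prime_gt_0_nat)
  show ?thesis
    unfolding xy
    apply (subst padic_abs_divide_int)
    subgoal using a c by simp
    subgoal using b d by simp
    unfolding x' y'
    using a b c d p0
    by (simp add: padic_abs_divide_int prime_elem_multiplicity_mult_distrib[OF pe]
          power_int_add[symmetric] algebra_simps)
qed auto

lemma padic_abs_minus: "padic_abs p (- x) = padic_abs p x"
proof -
  have "padic_abs p (- 1) * padic_abs p (- 1) = 1"
    using padic_abs_mult[of "-1" "-1"] by (simp add: padic_abs_1)
  then have "padic_abs p (- 1) = 1"
    by (metis abs_of_nonneg abs_square_eq_1 padic_abs_nonneg power2_eq_square)
  then show ?thesis using padic_abs_mult[of "-1" x] by simp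
qed

lemma padic_abs_diff_commute: "padic_abs p (x - y) = padic_abs p (y - x)"
  using padic_abs_minus[of "x - y"] by simp

lemma padic_abs_inverse: "padic_abs p (inverse x) = inverse (padic_abs p x)"
proof (cases "x = 0")
  case False
  then have "padic_abs p x * padic_abs p (inverse x) = 1"
    using padic_abs_mult[of x "inverse x"] by (simp add: padic_abs_1)
  then show ?thesis by (metis inverse_unique)
qed auto

lemma padic_abs_add_le_max: "padic_abs p (x + y) \<le> max (padic_abs p x) (padic_abs p y)"
proof (cases "x = 0 \<or> y = 0 \<or> x + y = 0")
  case False
  obtain a b where x: "quotient_of x = (a, b)" by force
  obtain c d where y: "quotient_of y = (c, d)" by force
  have b: "b > 0" and d: "d > 0" using quotient_of_denom_pos x y by auto
  have x0: "x = of_int a / of_int b" and y0: "y = of_int c / of_int d"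
    using quotient_of_div x y by auto
  define u v w where "u = a * d" and "v = c * b" and "w = b * d"
  have w: "w \<noteq> 0" using b d by (simp add: w_def)
  have x': "x = of_int u / of_int w" and y': "y = of_int v / of_int w"
    using b d by (simp_all add: x0 y0 u_def v_def w_def)
  have xy: "x + y = of_int (u + v) / of_int w" by (simp add: x' y' add_divide_distrib)
  have nz: "u \<noteq> 0" "v \<noteq> 0" "u + v \<noteq> 0" using False x' y' xy by auto
  define m where "m = min (multiplicity (int p) u) (multiplicity (int p) v)"
  have "int p ^ m dvd u + v"
    unfolding m_def by (intro dvd_add multiplicity_dvd') auto
  then have "m \<le> multiplicity (int p) (u + v)"
    using nz p by (intro multiplicity_geI) auto
  then have "real p powi (int (multiplicity (int p) w) - int (multiplicity (int p) (u + v)))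
      \<le> real p powi (int (multiplicity (int p) w) - int m)"
    using prime_ge_1_nat[OF p] by (intro power_int_increasing) auto
  also have "\<dots> \<le> max (padic_abs p x) (padic_abs p y)"
    unfolding x' y' padic_abs_divide_int[OF nz(1) w] padic_abs_divide_int[OF nz(2) w] m_def
    by (auto simp: min_def)
  finally show ?thesis
    unfolding xy padic_abs_divide_int[OF nz(3) w] .
qed (auto simp: le_max_iff_disj)

lemma padic_abs_add_le: "padic_abs p (x + y) \<le> padic_abs p x + padic_abs p y"
  using padic_abs_add_le_max[of x y] padic_abs_nonneg[of p x] padic_abs_nonneg[of p y] by linarith

lemma padic_abs_diff_triangle: "\<bar>padic_abs p x - padic_abs p y\<bar> \<le> padic_abs p (x - y)"
  using padic_abs_add_le[of "x - y" y] padic_abs_add_le[of "y - x" x]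
    padic_abs_diff_commute[of x y] by simp

end


subsection \<open>Cauchy sequences and null sequences of rationals\<close>

definition padic_cauchy :: "nat \<Rightarrow> (nat \<Rightarrow> rat) \<Rightarrow> bool" where
  "padic_cauchy p X \<longleftrightarrow> (\<forall>e>0. \<exists>N. \<forall>m\<ge>N. \<forall>n\<ge>N. padic_abs p (X m - X n) < e)"

definition padic_null :: "nat \<Rightarrow> (nat \<Rightarrow> rat) \<Rightarrow> bool" where
  "padic_null p X \<longleftrightarrow> (\<lambda>n. padic_abs p (X n)) \<longlonglongrightarrow> 0"

definition padic_rel :: "nat \<Rightarrow> (nat \<Rightarrow> rat) \<Rightarrow> (nat \<Rightarrow> rat) \<Rightarrow> bool" where
  "padic_rel p X Y \<longleftrightarrow> padic_cauchy p X \<and> padic_cauchy p Y \<and> padic_null p (\<lambda>n. X n - Y n)"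

lemma padic_cauchy_const [simp]: "padic_cauchy p (\<lambda>n. c)"
  by (simp add: padic_cauchy_def)

lemma padic_null_0 [simp]: "padic_null p (\<lambda>n. 0)"
  by (simp add: padic_null_def)

context
  fixes p :: nat
  assumes p: "prime p"
begin

lemma padic_null_const: "padic_null p (\<lambda>n. c) \<longleftrightarrow> c = 0"
  by (simp add: padic_null_def LIMSEQ_const_iff padic_abs_eq_0_iff[OF p])

lemma padic_null_bound:
  assumes "(\<lambda>n. g n) \<longlonglongrightarrow> 0" "\<And>n. padic_abs p (X n) \<le> g n"
  shows "padic_null p X"
  unfolding padic_null_def
  by (rule tendsto_sandwich[OF _ _ tendsto_const assms(1)]) (auto simp: assms(2))

lemma padic_null_add: "padic_null p X \<Longrightarrow> padic_null p Y \<Longrightarrow> padic_null p (\<lambda>n. X n + Y n)"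
  by (rule padic_null_bound[where g = "\<lambda>n. padic_abs p (X n) + padic_abs p (Y n)"])
     (auto simp: padic_null_def padic_abs_add_le[OF p] intro: tendsto_add_zero)

lemma padic_null_minus: "padic_null p X \<Longrightarrow> padic_null p (\<lambda>n. - X n)"
  by (simp add: padic_null_def padic_abs_minus[OF p])

lemma padic_null_diff: "padic_null p X \<Longrightarrow> padic_null p Y \<Longrightarrow> padic_null p (\<lambda>n. X n - Y n)"
  using padic_null_add[OF _ padic_null_minus, of X Y] by simp

lemma padic_cauchy_bounded:
  assumes "padic_cauchy p X"
  obtains B where "B > 0" "\<And>n. padic_abs p (X n) \<le> B"
proof -
  obtain N where N: "\<And>m n. m \<ge> N \<Longrightarrow> n \<ge> N \<Longrightarrow> padic_abs p (X m - X n) < 1"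
    using assms unfolding padic_cauchy_def by (meson zero_less_one)
  define B where "B = 1 + (\<Sum>k\<le>N. padic_abs p (X k))"
  have S: "padic_abs p (X k) \<le> (\<Sum>k\<le>N. padic_abs p (X k))" if "k \<le> N" for k
    using that by (intro member_le_sum) auto
  have "padic_abs p (X n) \<le> B" for n
  proof (cases "n \<le> N")
    case True
    then show ?thesis using S[of n] by (simp add: B_def)
  next
    case False
    have "padic_abs p (X n) \<le> padic_abs p (X n - X N) + padic_abs p (X N)"
      using padic_abs_add_le[OF p, of "X n - X N" "X N"] by simp
    also have "\<dots> \<le> B" using N[of n N] S[of N] False by (simp add: B_def)
    finally show ?thesis .
  qed
  moreover have "B > 0" unfolding B_def
    by (smt (verit) padic_abs_nonneg sum_nonneg)
  ultimately show ?thesis using that by blast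
qed

lemma padic_null_mult_bounded:
  assumes "\<And>n. padic_abs p (X n) \<le> B" "padic_null p Y"
  shows "padic_null p (\<lambda>n. X n * Y n)"
proof (rule padic_null_bound[where g = "\<lambda>n. B * padic_abs p (Y n)"])
  show "(\<lambda>n. B * padic_abs p (Y n)) \<longlonglongrightarrow> 0"
    using assms(2) unfolding padic_null_def by (rule tendsto_mult_right_zero)
  show "padic_abs p (X n * Y n) \<le> B * padic_abs p (Y n)" for n
    unfolding padic_abs_mult[OF p] by (intro mult_right_mono assms(1)) auto
qed

lemma padic_null_mult_cauchy:
  assumes "padic_cauchy p X" "padic_null p Y"
  shows "padic_null p (\<lambda>n. X n * Y n)"
proof -
  obtain B where "\<And>n. padic_abs p (X n) \<le> B"
    using padic_cauchy_bounded[OF assms(1)] by blast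
  then show ?thesis using assms(2) by (rule padic_null_mult_bounded)
qed

lemma padic_cauchy_bound:
  assumes "padic_cauchy p X" "padic_cauchy p Y" "C > 0"
    and "\<And>m n. m \<ge> M \<Longrightarrow> n \<ge> M \<Longrightarrow>
      padic_abs p (Z m - Z n) \<le> C * (padic_abs p (X m - X n) + padic_abs p (Y m - Y n))"
  shows "padic_cauchy p Z"
  unfolding padic_cauchy_def
proof (intro allI impI)
  fix e :: real assume "e > 0"
  then have e: "e / (2 * C) > 0" using \<open>C > 0\<close> by simp
  obtain N1 where N1: "\<And>m n. m \<ge> N1 \<Longrightarrow> n \<ge> N1 \<Longrightarrow> padic_abs p (X m - X n) < e / (2 * C)"
    using assms(1) e unfolding padic_cauchy_def by blast
  obtain N2 where N2: "\<And>m n. m \<ge> N2 \<Longrightarrow> n \<ge> N2 \<Longrightarrow> padic_abs p (Y m - Y n) < e / (2 * C)"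
    using assms(2) e unfolding padic_cauchy_def by blast
  have "padic_abs p (Z m - Z n) < e" if "m \<ge> max M (max N1 N2)" "n \<ge> max M (max N1 N2)" for m n
  proof -
    have "padic_abs p (Z m - Z n) \<le> C * (padic_abs p (X m - X n) + padic_abs p (Y m - Y n))"
      using that by (intro assms(4)) auto
    also have "\<dots> < C * (e / (2 * C) + e / (2 * C))"
      using that by (intro mult_strict_left_mono add_strict_mono N1 N2 \<open>C > 0\<close>) auto
    also have "\<dots> = e" using \<open>C > 0\<close> by (simp add: field_simps)
    finally show ?thesis .
  qed
  then show "\<exists>N. \<forall>m\<ge>N. \<forall>n\<ge>N. padic_abs p (Z m - Z n) < e" by blast
qed

lemma padic_cauchy_add:
  "padic_cauchy p X \<Longrightarrow> padic_cauchy p Y \<Longrightarrow> padic_cauchy p (\<lambda>n. X n + Y n)"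
  by (rule padic_cauchy_bound[of X Y 1 0]) (simp_all only: add_diff_add padic_abs_add_le[OF p] mult_1 zero_less_one)

lemma padic_cauchy_minus: "padic_cauchy p X \<Longrightarrow> padic_cauchy p (\<lambda>n. - X n)"
  unfolding padic_cauchy_def minus_diff_minus padic_abs_minus[OF p] .

lemma padic_cauchy_mult:
  assumes "padic_cauchy p X" "padic_cauchy p Y"
  shows "padic_cauchy p (\<lambda>n. X n * Y n)"
proof -
  obtain A where A: "A > 0" "\<And>n. padic_abs p (X n) \<le> A"
    using padic_cauchy_bounded[OF assms(1)] by blast
  obtain B where B: "B > 0" "\<And>n. padic_abs p (Y n) \<le> B"
    using padic_cauchy_bounded[OF assms(2)] by blast
  show ?thesis
  proof (rule padic_cauchy_bound[OF assms, where C = "A + B" and M = 0])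
    fix m n
    have "padic_abs p (X m * Y m - X n * Y n)
        \<le> padic_abs p (X m) * padic_abs p (Y m - Y n) + padic_abs p (X m - X n) * padic_abs p (Y n)"
      unfolding mult_diff_mult padic_abs_mult[OF p, symmetric] by (rule padic_abs_add_le[OF p])
    also have "\<dots> \<le> (A + B) * padic_abs p (Y m - Y n) + padic_abs p (X m - X n) * (A + B)"
    proof (intro add_mono mult_right_mono mult_left_mono)
      show "padic_abs p (X m) \<le> A + B" using A(2)[of m] B(1) by linarith
      show "padic_abs p (Y n) \<le> A + B" using A(1) B(2)[of n] by linarith
    qed simp_all
    finally show "padic_abs p (X m * Y m - X n * Y n)
        \<le> (A + B) * (padic_abs p (X m - X n) + padic_abs p (Y m - Y n))"
      by (simp add: algebra_simps)
  qed (use A B in simp)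
qed

lemma padic_cauchy_not_null:
  assumes X: "padic_cauchy p X" and nn: "\<not> padic_null p X"
  obtains b N where "b > 0" "\<And>n. n \<ge> N \<Longrightarrow> padic_abs p (X n) > b"
proof -
  obtain r where r: "r > 0" "\<And>N. \<exists>n\<ge>N. padic_abs p (X n) \<ge> r"
    using nn unfolding padic_null_def LIMSEQ_iff by (auto simp: not_less)
  obtain N where N: "\<And>m n. m \<ge> N \<Longrightarrow> n \<ge> N \<Longrightarrow> padic_abs p (X m - X n) < r / 2"
    using X r(1) unfolding padic_cauchy_def by (meson half_gt_zero)
  obtain k where k: "k \<ge> N" "padic_abs p (X k) \<ge> r" using r(2) by blast
  have "padic_abs p (X n) > r / 2" if "n \<ge> N" for n
    using padic_abs_add_le[OF p, of "X k - X n" "X n"] N[OF k(1) that] k(2) by simp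
  then show ?thesis using that r(1) by (meson half_gt_zero)
qed

lemma padic_abs_inverse_diff_le:
  assumes "b > 0" "padic_abs p x > b" "padic_abs p y > b"
  shows "padic_abs p (inverse x - inverse y) \<le> inverse b * inverse b * padic_abs p (x - y)"
proof -
  have "x \<noteq> 0" "y \<noteq> 0" using assms by auto
  then have "padic_abs p (inverse x - inverse y)
      = inverse (padic_abs p x) * padic_abs p (x - y) * inverse (padic_abs p y)"
    by (simp add: inverse_diff_inverse padic_abs_minus[OF p] padic_abs_mult[OF p]
        padic_abs_inverse[OF p])
  also have "\<dots> \<le> inverse b * padic_abs p (x - y) * inverse b"
    using assms by (intro mult_mono le_imp_inverse_le mult_nonneg_nonneg) auto
  finally show ?thesis by (simp add: mult_ac)
qed

lemma padic_cauchy_inverse: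
  assumes X: "padic_cauchy p X" and nn: "\<not> padic_null p X"
  shows "padic_cauchy p (\<lambda>n. inverse (X n))"
proof -
  obtain b N where b: "b > 0" "\<And>n. n \<ge> N \<Longrightarrow> padic_abs p (X n) > b"
    using padic_cauchy_not_null[OF assms] by blast
  show ?thesis
  proof (rule padic_cauchy_bound[OF X X, where C = "inverse b * inverse b" and M = N])
    fix m n assume "m \<ge> N" "n \<ge> N"
    then have "padic_abs p (inverse (X m) - inverse (X n))
        \<le> inverse b * inverse b * padic_abs p (X m - X n)"
      using b by (intro padic_abs_inverse_diff_le) auto
    also have "\<dots> \<le> inverse b * inverse b * (padic_abs p (X m - X n) + padic_abs p (X m - X n))"
      using b(1) by (intro mult_left_mono) auto
    finally show "padic_abs p (inverse (X m) - inverse (X n))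
        \<le> inverse b * inverse b * (padic_abs p (X m - X n) + padic_abs p (X m - X n))" .
  qed (use b in auto)
qed

lemma padic_null_diff_inverse:
  assumes X: "padic_cauchy p X" "\<not> padic_null p X" and Y: "padic_cauchy p Y" "\<not> padic_null p Y"
    and XY: "padic_null p (\<lambda>n. X n - Y n)"
  shows "padic_null p (\<lambda>n. inverse (X n) - inverse (Y n))"
proof -
  obtain a N1 where a: "a > 0" "\<And>n. n \<ge> N1 \<Longrightarrow> padic_abs p (X n) > a"
    using padic_cauchy_not_null[OF X] by blast
  obtain b N2 where b: "b > 0" "\<And>n. n \<ge> N2 \<Longrightarrow> padic_abs p (Y n) > b"
    using padic_cauchy_not_null[OF Y] by blast
  define c where "c = min a b"
  have c: "c > 0" using a b by (simp add: c_def)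
  have "padic_abs p (inverse (X n) - inverse (Y n)) \<le> inverse c * inverse c * padic_abs p (X n - Y n)"
    if "n \<ge> max N1 N2" for n
    using a(2)[of n] b(2)[of n] that c
    by (intro padic_abs_inverse_diff_le) (auto simp: c_def)
  then have "\<forall>\<^sub>F n in sequentially. padic_abs p (inverse (X n) - inverse (Y n))
      \<le> inverse c * inverse c * padic_abs p (X n - Y n)"
    unfolding eventually_sequentially by blast
  moreover have "(\<lambda>n. inverse c * inverse c * padic_abs p (X n - Y n)) \<longlonglongrightarrow> 0"
    using XY unfolding padic_null_def by (rule tendsto_mult_right_zero)
  ultimately show ?thesis
    unfolding padic_null_def
    by (rule tendsto_sandwich[OF always_eventually _ tendsto_const, rotated]) simp
qed

lemma padic_abs_convergent:
  assumes "padic_cauchy p X"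
  shows "convergent (\<lambda>n. padic_abs p (X n))"
proof (rule real_Cauchy_convergent, rule metric_CauchyI)
  fix e :: real assume "e > 0"
  then obtain N where N: "\<And>m n. m \<ge> N \<Longrightarrow> n \<ge> N \<Longrightarrow> padic_abs p (X m - X n) < e"
    using assms unfolding padic_cauchy_def by blast
  have "dist (padic_abs p (X m)) (padic_abs p (X n)) < e" if "m \<ge> N" "n \<ge> N" for m n
    unfolding dist_real_def using padic_abs_diff_triangle[OF p] N[OF that] by (rule le_less_trans)
  then show "\<exists>M. \<forall>m\<ge>M. \<forall>n\<ge>M. dist (padic_abs p (X m)) (padic_abs p (X n)) < e"
    by blast
qed

lemma padic_rel_refl: "padic_cauchy p X \<Longrightarrow> padic_rel p X X"
  by (simp add: padic_rel_def)

lemma part_equivp_padic_rel: "part_equivp (padic_rel p)"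
proof (rule part_equivpI)
  show "\<exists>X. padic_rel p X X" using padic_rel_refl[OF padic_cauchy_const] by blast
  show "symp (padic_rel p)"
    by (auto simp: symp_def padic_rel_def padic_null_def padic_abs_diff_commute[OF p])
  show "transp (padic_rel p)"
  proof (rule transpI)
    fix X Y Z assume "padic_rel p X Y" "padic_rel p Y Z"
    then show "padic_rel p X Z"
      using padic_null_add[of "\<lambda>n. X n - Y n" "\<lambda>n. Y n - Z n"] by (simp add: padic_rel_def)
  qed
qed

end


subsection \<open>The completion\<close>

text \<open>
  The prime enters as the cardinality of the phantom type \<open>'p\<close>: \<open>'p padic\<close> is the completion of the
  rationals with respect to the \<open>p\<close>-adic absolute value for \<open>p = CARD('p)\<close>.
\<close>

typedef (overloaded) ('p::prime_card) padic =
  "{C. \<exists>X. padic_rel CARD('p) X X \<and> C = Collect (padic_rel CARD('p) X)}"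
  using padic_rel_refl[OF prime_card padic_cauchy_const] by blast

(* quotient_type drops the sort constraint on a phantom type variable, so the quotient
   theorem for lifting is set up by hand. *)

lemma quot_type_padic:
  "quot_type (padic_rel CARD('p)) Abs_padic (Rep_padic :: 'p::prime_card padic \<Rightarrow> _)"
proof
  fix y :: "'p padic"
  show "\<exists>x. padic_rel CARD('p) x x \<and> Rep_padic y = Collect (padic_rel CARD('p) x)"
    using Rep_padic[of y] by blast
qed (auto simp: Rep_padic_inverse Abs_padic_inverse Rep_padic_inject
    part_equivp_padic_rel[OF prime_card])

definition padic_of_seq :: "(nat \<Rightarrow> rat) \<Rightarrow> 'p::prime_card padic" where
  "padic_of_seq X = Abs_padic (Collect (padic_rel CARD('p) X))"

definition seq_of_padic :: "'p::prime_card padic \<Rightarrow> nat \<Rightarrow> rat" where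
  "seq_of_padic x = (SOME X. X \<in> Rep_padic x)"

definition cr_padic :: "(nat \<Rightarrow> rat) \<Rightarrow> 'p::prime_card padic \<Rightarrow> bool" where
  "cr_padic = (\<lambda>X x. padic_rel CARD('p) X X \<and> padic_of_seq X = x)"

lemma Quotient_padic:
  "Quotient (padic_rel CARD('p)) padic_of_seq seq_of_padic (cr_padic :: _ \<Rightarrow> 'p::prime_card padic \<Rightarrow> _)"
proof -
  have "padic_of_seq = quot_type.abs (padic_rel CARD('p)) (Abs_padic :: _ \<Rightarrow> 'p padic)"
    "seq_of_padic = quot_type.rep (Rep_padic :: 'p padic \<Rightarrow> _)"
    by (auto simp: fun_eq_iff padic_of_seq_def seq_of_padic_def
        quot_type.abs_def[OF quot_type_padic] quot_type.rep_def[OF quot_type_padic])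
  then have "Quotient3 (padic_rel CARD('p)) padic_of_seq (seq_of_padic :: 'p padic \<Rightarrow> _)"
    using quot_type.Quotient[OF quot_type_padic[where 'p = 'p]] by simp
  then show ?thesis
    by (rule Quotient3_to_Quotient) (simp add: cr_padic_def)
qed

setup_lifting Quotient_padic

instantiation padic :: (prime_card) field
begin

lift_definition zero_padic :: "'a padic" is "\<lambda>n. 0"
  by (simp add: padic_rel_refl[OF prime_card])

lift_definition one_padic :: "'a padic" is "\<lambda>n. 1"
  by (simp add: padic_rel_refl[OF prime_card])

lift_definition plus_padic :: "'a padic \<Rightarrow> 'a padic \<Rightarrow> 'a padic" is "\<lambda>X Y n. X n + Y n"
  unfolding padic_rel_def add_diff_add
  by (simp add: padic_cauchy_add[OF prime_card] padic_null_add[OF prime_card])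

lift_definition uminus_padic :: "'a padic \<Rightarrow> 'a padic" is "\<lambda>X n. - X n"
  unfolding padic_rel_def minus_diff_minus
  by (simp only: padic_cauchy_minus[OF prime_card] padic_null_minus[OF prime_card] simp_thms)

lift_definition times_padic :: "'a padic \<Rightarrow> 'a padic \<Rightarrow> 'a padic" is "\<lambda>X Y n. X n * Y n"
proof -
  fix f1 f2 f3 f4 :: "nat \<Rightarrow> rat"
  let ?p = "CARD('a)"
  assume a: "padic_rel ?p f1 f2" "padic_rel ?p f3 f4"
  then have "padic_null ?p (\<lambda>n. f1 n * (f3 n - f4 n) + f4 n * (f1 n - f2 n))"
    by (intro padic_null_add[OF prime_card] padic_null_mult_cauchy[OF prime_card])
       (auto simp: padic_rel_def)
  moreover have "f1 n * (f3 n - f4 n) + f4 n * (f1 n - f2 n) = f1 n * f3 n - f2 n * f4 n" for n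
    by (simp add: algebra_simps)
  ultimately show "padic_rel ?p (\<lambda>n. f1 n * f3 n) (\<lambda>n. f2 n * f4 n)"
    using a by (simp add: padic_rel_def padic_cauchy_mult[OF prime_card])
qed

lift_definition inverse_padic :: "'a padic \<Rightarrow> 'a padic"
  is "\<lambda>X. if padic_null CARD('a) X then (\<lambda>n. 0) else (\<lambda>n. inverse (X n))"
proof -
  fix X Y :: "nat \<Rightarrow> rat"
  let ?p = "CARD('a)"
  assume "padic_rel ?p X Y"
  then have XY: "padic_cauchy ?p X" "padic_cauchy ?p Y" "padic_null ?p (\<lambda>n. X n - Y n)"
    by (simp_all add: padic_rel_def)
  have "padic_null ?p X \<longleftrightarrow> padic_null ?p Y"
    using padic_null_diff[OF prime_card _ XY(3), of X] padic_null_add[OF prime_card XY(3), of Y] by auto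
  then show "padic_rel ?p (if padic_null ?p X then \<lambda>n. 0 else (\<lambda>n. inverse (X n)))
      (if padic_null ?p Y then \<lambda>n. 0 else (\<lambda>n. inverse (Y n)))"
    by (simp add: XY padic_rel_def padic_cauchy_inverse[OF prime_card]
        padic_null_diff_inverse[OF prime_card])
qed

definition minus_padic :: "'a padic \<Rightarrow> 'a padic \<Rightarrow> 'a padic" where
  "minus_padic x y = x + - y"

definition divide_padic :: "'a padic \<Rightarrow> 'a padic \<Rightarrow> 'a padic" where
  "divide_padic x y = x * inverse y"

instance
proof
  fix a b c :: "'a padic"
  note simps = padic_rel_def padic_cauchy_add[OF prime_card] padic_cauchy_mult[OF prime_card]
  show "a + b + c = a + (b + c)"
    by transfer (simp add: ac_simps simps)
  show "a + b = b + a"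
    by transfer (simp add: ac_simps simps)
  show "0 + a = a"
    by transfer (simp add: simps)
  show "- a + a = 0"
    by transfer (simp add: simps)
  show "a - b = a + - b"
    by (rule minus_padic_def)
  show "a * b * c = a * (b * c)"
    by transfer (simp add: ac_simps simps)
  show "a * b = b * a"
    by transfer (simp add: ac_simps simps)
  show "1 * a = a"
    by transfer (simp add: simps)
  show "(a + b) * c = a * c + b * c"
    by transfer (simp add: distrib_right simps)
  show "(0::'a padic) \<noteq> 1"
    by transfer (simp add: simps padic_null_const[OF prime_card])
  show "inverse a * a = 1" if "a \<noteq> 0"
    using that
  proof transfer
    fix X :: "nat \<Rightarrow> rat"
    assume "padic_rel CARD('a) X X" "\<not> padic_rel CARD('a) X (\<lambda>n. 0)"
    then have X: "padic_cauchy CARD('a) X" "\<not> padic_null CARD('a) X"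
      by (simp_all add: padic_rel_def)
    obtain b N where b: "b > 0" "\<And>n. n \<ge> N \<Longrightarrow> padic_abs CARD('a) (X n) > b"
      using padic_cauchy_not_null[OF prime_card X] by blast
    have nz: "X n \<noteq> 0" if "n \<ge> N" for n
    proof
      assume "X n = 0"
      with b(1) b(2)[OF that] show False by simp
    qed
    have "\<forall>\<^sub>F n in sequentially. padic_abs CARD('a) (inverse (X n) * X n - 1) = 0"
      unfolding eventually_sequentially by (rule exI[of _ N]) (simp add: nz)
    then have "padic_null CARD('a) (\<lambda>n. inverse (X n) * X n - 1)"
      unfolding padic_null_def by (rule tendsto_eventually)
    moreover have "padic_cauchy CARD('a) (\<lambda>n. inverse (X n) * X n)"
      by (intro padic_cauchy_mult[OF prime_card] padic_cauchy_inverse[OF prime_card] X)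
    ultimately show "padic_rel CARD('a)
        (\<lambda>n. (if padic_null CARD('a) X then \<lambda>n. 0 else (\<lambda>n. inverse (X n))) n * X n) (\<lambda>n. 1)"
      using X(2) by (simp add: padic_rel_def)
  qed
  show "a div b = a * inverse b"
    by (rule divide_padic_def)
  show "inverse (0::'a padic) = 0"
    by transfer (simp add: simps)
qed

end


subsection \<open>The p-adic norm and metric\<close>

lift_definition padic_norm :: "'p::prime_card padic \<Rightarrow> real"
  is "\<lambda>X. lim (\<lambda>n. padic_abs CARD('p) (X n))"
proof -
  fix X Y :: "nat \<Rightarrow> rat"
  let ?p = "CARD('p)"
  assume "padic_rel ?p X Y"
  then have XY: "padic_cauchy ?p X" "padic_cauchy ?p Y" "padic_null ?p (\<lambda>n. X n - Y n)"
    by (simp_all add: padic_rel_def)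
  obtain l where l: "(\<lambda>n. padic_abs ?p (Y n)) \<longlonglongrightarrow> l"
    using padic_abs_convergent[OF prime_card XY(2)] by (auto simp: convergent_def)
  have "(\<lambda>n. padic_abs ?p (X n) - padic_abs ?p (Y n)) \<longlonglongrightarrow> 0"
    by (rule tendsto_rabs_zero_cancel,
        rule tendsto_sandwich[OF _ _ tendsto_const XY(3)[unfolded padic_null_def]])
       (auto simp: padic_abs_diff_triangle[OF prime_card])
  from tendsto_add[OF this l] have "(\<lambda>n. padic_abs ?p (X n)) \<longlonglongrightarrow> l" by simp
  from limI[OF this] limI[OF l]
  show "lim (\<lambda>n. padic_abs ?p (X n)) = lim (\<lambda>n. padic_abs ?p (Y n))" by (rule trans[OF _ sym])
qed

lemma padic_abs_tendsto_lim:
  "padic_cauchy CARD('p::prime_card) X \<Longrightarrow>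
     (\<lambda>n. padic_abs CARD('p) (X n)) \<longlonglongrightarrow> lim (\<lambda>n. padic_abs CARD('p) (X n))"
  by (rule convergent_LIMSEQ_iff[THEN iffD1, OF padic_abs_convergent[OF prime_card]])

lemma padic_norm_nonneg [simp]: "padic_norm x \<ge> 0"
proof (transfer)
  fix X :: "nat \<Rightarrow> rat"
  assume "padic_rel CARD('a) X X"
  then have "padic_cauchy CARD('a) X" by (simp add: padic_rel_def)
  from padic_abs_tendsto_lim[OF this] show "0 \<le> lim (\<lambda>n. padic_abs CARD('a) (X n))"
    by (rule LIMSEQ_le_const) auto
qed

lemma padic_norm_eq_0_iff [simp]: "padic_norm x = 0 \<longleftrightarrow> x = 0"
proof (transfer)
  fix X :: "nat \<Rightarrow> rat"
  assume "padic_rel CARD('a) X X"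
  then have X: "padic_cauchy CARD('a) X" by (simp add: padic_rel_def)
  note l = padic_abs_tendsto_lim[OF X]
  show "lim (\<lambda>n. padic_abs CARD('a) (X n)) = 0 \<longleftrightarrow> padic_rel CARD('a) X (\<lambda>n. 0)"
    using l X by (auto simp: padic_rel_def padic_null_def intro: limI)
qed

lemma padic_norm_mult: "padic_norm (x * y) = padic_norm x * padic_norm y"
proof (transfer)
  fix X Y :: "nat \<Rightarrow> rat"
  assume "padic_rel CARD('a) X X" "padic_rel CARD('a) Y Y"
  then have X: "padic_cauchy CARD('a) X" and Y: "padic_cauchy CARD('a) Y"
    by (simp_all add: padic_rel_def)
  show "lim (\<lambda>n. padic_abs CARD('a) (X n * Y n)) =
      lim (\<lambda>n. padic_abs CARD('a) (X n)) * lim (\<lambda>n. padic_abs CARD('a) (Y n))"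
    unfolding padic_abs_mult[OF prime_card]
    by (intro limI tendsto_mult padic_abs_tendsto_lim X Y)
qed

lemma padic_norm_add_le_max: "padic_norm (x + y) \<le> max (padic_norm x) (padic_norm y)"
proof (transfer)
  fix X Y :: "nat \<Rightarrow> rat"
  assume "padic_rel CARD('a) X X" "padic_rel CARD('a) Y Y"
  then have X: "padic_cauchy CARD('a) X" and Y: "padic_cauchy CARD('a) Y"
    by (simp_all add: padic_rel_def)
  show "lim (\<lambda>n. padic_abs CARD('a) (X n + Y n)) \<le>
      max (lim (\<lambda>n. padic_abs CARD('a) (X n))) (lim (\<lambda>n. padic_abs CARD('a) (Y n)))"
    by (rule LIMSEQ_le[OF padic_abs_tendsto_lim
          tendsto_max[OF padic_abs_tendsto_lim[OF X] padic_abs_tendsto_lim[OF Y]]])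
       (auto simp: padic_cauchy_add[OF prime_card X Y] padic_abs_add_le_max[OF prime_card])
qed

lemma padic_norm_minus [simp]: "padic_norm (- x) = padic_norm x"
  by (transfer) (simp add: padic_abs_minus[OF prime_card])

lemma padic_norm_minus_commute: "padic_norm (x - y) = padic_norm (y - x)"
  using padic_norm_minus[of "x - y"] by simp

lemma padic_norm_add_le: "padic_norm (x + y) \<le> padic_norm x + padic_norm y"
  using padic_norm_add_le_max[of x y] padic_norm_nonneg[of x] padic_norm_nonneg[of y] by linarith

instantiation padic :: (prime_card) metric_space
begin

definition dist_padic :: "'a padic \<Rightarrow> 'a padic \<Rightarrow> real" where
  "dist_padic x y = padic_norm (x - y)"

definition uniformity_padic :: "('a padic \<times> 'a padic) filter" where
  "uniformity_padic = (INF e\<in>{0<..}. principal {(x, y). dist x y < e})"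

definition open_padic :: "'a padic set \<Rightarrow> bool" where
  "open_padic U \<longleftrightarrow> (\<forall>x\<in>U. \<forall>\<^sub>F (x', y) in uniformity. x' = x \<longrightarrow> y \<in> U)"

instance
proof
  fix x y z :: "'a padic"
  show "dist x y = 0 \<longleftrightarrow> x = y"
    by (simp add: dist_padic_def)
  show "dist x y \<le> dist x z + dist y z"
    using padic_norm_add_le[of "x - z" "z - y"]
    by (simp add: dist_padic_def padic_norm_minus_commute[of y z])
qed (rule uniformity_padic_def open_padic_def)+

end

lemma cball_padic: "cball a r = {x. padic_norm (x - a) \<le> r}"
  by (auto simp: dist_padic_def padic_norm_minus_commute[of a])


subsection \<open>The rationals are dense and the field is complete\<close>

lift_definition padic_of_rat :: "rat \<Rightarrow> 'p::prime_card padic" is "\<lambda>q n. q"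
  by (simp add: padic_rel_refl[OF prime_card])

lemma padic_norm_padic_of_rat:
  "padic_norm (padic_of_rat q :: 'p::prime_card padic) = padic_abs CARD('p) q"
  by transfer (rule limI, rule tendsto_const)

lemma padic_of_rat_hom:
  "padic_of_rat 0 = 0" "padic_of_rat 1 = 1"
  "padic_of_rat (x + y) = padic_of_rat x + padic_of_rat y"
  "padic_of_rat (- x) = - padic_of_rat x"
  "padic_of_rat (x * y) = padic_of_rat x * padic_of_rat y"
  by (transfer; simp add: padic_rel_refl[OF prime_card])+

lemma of_nat_padic: "of_nat n = padic_of_rat (of_nat n)"
  by (induction n) (simp_all add: padic_of_rat_hom)

lemma of_int_padic: "of_int n = padic_of_rat (of_int n)"
  by (cases n) (simp_all add: of_nat_padic padic_of_rat_hom del: of_nat_Suc)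

instance padic :: (prime_card) field_char_0
proof (standard, rule injI)
  fix m n :: nat
  assume "of_nat m = (of_nat n :: 'a padic)"
  then have "padic_of_rat (of_nat m + - of_nat n) = (0 :: 'a padic)"
    by (simp only: padic_of_rat_hom of_nat_padic add.right_inverse)
  then have "padic_abs CARD('a) (of_nat m + - of_nat n) = 0"
    by (metis padic_norm_padic_of_rat padic_norm_eq_0_iff)
  then show "m = n" by (simp add: padic_abs_eq_0_iff[OF prime_card])
qed

lemma of_rat_padic: "of_rat q = (padic_of_rat q :: 'p::prime_card padic)"
proof -
  obtain a b where q: "quotient_of q = (a, b)" by force
  have b: "b > 0" and q': "q = of_int a / of_int b"
    using quotient_of_denom_pos[OF q] quotient_of_div[OF q] by auto
  have "(padic_of_rat q :: 'p padic) * of_int b = padic_of_rat (q * of_int b)"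
    by (simp add: of_int_padic padic_of_rat_hom)
  also have "q * of_int b = of_int a" using b q' by simp
  finally have "(padic_of_rat q :: 'p padic) * of_int b = of_int a" by (simp add: of_int_padic)
  then have "(padic_of_rat q :: 'p padic) = of_int a / of_int b" using b by (simp add: eq_divide_eq)
  then show ?thesis by (simp add: q' of_rat_divide)
qed

lemma padic_norm_of_rat: "padic_norm (of_rat q :: 'p::prime_card padic) = padic_abs CARD('p) q"
  by (simp add: of_rat_padic padic_norm_padic_of_rat)

lemma padic_of_seq_tendsto:
  assumes X: "padic_cauchy CARD('p::prime_card) X"
  shows "(\<lambda>n. of_rat (X n)) \<longlonglongrightarrow> (padic_of_seq X :: 'p padic)"
proof (rule metric_LIMSEQ_I)
  fix e :: real assume "e > 0"
  then obtain N where N: "\<And>m n. m \<ge> N \<Longrightarrow> n \<ge> N \<Longrightarrow> padic_abs CARD('p) (X m - X n) < e / 2"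
    using X unfolding padic_cauchy_def by (meson half_gt_zero)
  have "dist (of_rat (X n)) (padic_of_seq X :: 'p padic) < e" if n: "n \<ge> N" for n
  proof -
    have c: "padic_cauchy CARD('p) (\<lambda>k. X k + - X n)"
      by (intro padic_cauchy_add[OF prime_card] X padic_cauchy_const)
    have "padic_of_seq X + - padic_of_rat (X n) = (padic_of_seq (\<lambda>k. X k + - X n) :: 'p padic)"
      using X c by (simp add: padic_of_rat.abs_eq plus_padic.abs_eq uminus_padic.abs_eq
          padic_rel_refl[OF prime_card] padic_cauchy_minus[OF prime_card])
    then have "dist (of_rat (X n)) (padic_of_seq X :: 'p padic)
        = lim (\<lambda>k. padic_abs CARD('p) (X k + - X n))"
      using c by (subst dist_commute)
        (simp add: dist_padic_def of_rat_padic padic_norm.abs_eq padic_rel_refl[OF prime_card])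
    also have "\<dots> \<le> e / 2"
      using less_imp_le[OF N[OF _ n]]
      by (intro LIMSEQ_le_const2[OF padic_abs_tendsto_lim[OF c]] exI[of _ N]) simp
    finally show ?thesis using \<open>e > 0\<close> by simp
  qed
  then show "\<exists>N. \<forall>n\<ge>N. dist (of_rat (X n)) (padic_of_seq X :: 'p padic) < e" by blast
qed

lemma padic_rat_dense:
  fixes x :: "'p::prime_card padic"
  assumes "e > 0"
  shows "\<exists>q. dist x (of_rat q) < e"
proof -
  have "padic_rel CARD('p) (seq_of_padic x) (seq_of_padic x)"
    by (rule Quotient_rep_reflp[OF Quotient_padic])
  then have "(\<lambda>n. of_rat (seq_of_padic x n)) \<longlonglongrightarrow> (padic_of_seq (seq_of_padic x) :: 'p padic)"
    by (intro padic_of_seq_tendsto) (simp add: padic_rel_def)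
  then have "(\<lambda>n. of_rat (seq_of_padic x n)) \<longlonglongrightarrow> x"
    by (simp add: Quotient_abs_rep[OF Quotient_padic])
  from metric_LIMSEQ_D[OF this \<open>e > 0\<close>] show ?thesis
    by (metis dist_commute order_refl)
qed

instance padic :: (prime_card) complete_space
proof
  fix S :: "nat \<Rightarrow> 'a padic"
  assume S: "Cauchy S"
  have "\<exists>q. dist (S n) (of_rat q) < 1 / Suc n" for n by (rule padic_rat_dense) simp
  then obtain Q where Q: "\<And>n. dist (S n) (of_rat (Q n)) < 1 / Suc n" by metis
  have z: "(\<lambda>n. dist (S n) (of_rat (Q n))) \<longlonglongrightarrow> 0"
    by (rule tendsto_sandwich[OF always_eventually always_eventually tendsto_const
          LIMSEQ_Suc[OF lim_1_over_n]])
       (use less_imp_le[OF Q] in simp_all)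
  have "padic_cauchy CARD('a) Q"
    unfolding padic_cauchy_def
  proof (intro allI impI)
    fix e :: real assume "e > 0"
    then have e: "e / 3 > 0" by simp
    obtain M where M: "\<And>m n. m \<ge> M \<Longrightarrow> n \<ge> M \<Longrightarrow> dist (S m) (S n) < e / 3"
      using S e unfolding Cauchy_def by blast
    obtain N where N: "\<And>n. n \<ge> N \<Longrightarrow> dist (S n) (of_rat (Q n)) < e / 3"
      using metric_LIMSEQ_D[OF z e] by auto
    have "padic_abs CARD('a) (Q m - Q n) < e" if "m \<ge> max M N" "n \<ge> max M N" for m n
    proof -
      have "padic_abs CARD('a) (Q m - Q n) = dist (of_rat (Q m)) (of_rat (Q n) :: 'a padic)"
        by (simp add: dist_padic_def padic_norm_of_rat flip: of_rat_diff)
      also have "\<dots> \<le> dist (S m) (of_rat (Q m)) + dist (S m) (S n) + dist (S n) (of_rat (Q n))"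
        by metric
      also have "\<dots> < e" using M[of m n] N[of m] N[of n] that by simp
      finally show ?thesis .
    qed
    then show "\<exists>N. \<forall>m\<ge>N. \<forall>n\<ge>N. padic_abs CARD('a) (Q m - Q n) < e" by blast
  qed
  then obtain L :: "'a padic" where L: "(\<lambda>n. of_rat (Q n)) \<longlonglongrightarrow> L"
    using padic_of_seq_tendsto by blast
  have "(\<lambda>n. dist (S n) (of_rat (Q n)) + dist (of_rat (Q n)) L) \<longlonglongrightarrow> 0"
    by (rule tendsto_add_zero[OF z L[unfolded tendsto_dist_iff[of _ L]]])
  then have "(\<lambda>n. dist (S n) L) \<longlonglongrightarrow> 0"
    by (rule tendsto_sandwich[OF always_eventually always_eventually tendsto_const, rotated 2])
       (simp_all add: dist_triangle)
  then have "S \<longlonglongrightarrow> L"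
    by (simp add: tendsto_dist_iff[of _ L])
  then show "convergent S" by (auto simp: convergent_def)
qed


section \<open>The Ising mapping and symbolic dynamics\<close>

definition padic_E :: "'p::prime_card padic set" where
  "padic_E = {x. padic_norm (x - 1) \<le> 1 / real CARD('p)}"

(* At the pole x = - \<theta> the quotient is 0 by the totality of division; in the situation of interest
   the pole lies outside the domain X of the map. *)
definition ising_map :: "nat \<Rightarrow> 'a::field \<Rightarrow> 'a \<Rightarrow> 'a" where
  "ising_map k \<theta> x = ((\<theta> * x + 1) / (x + \<theta>)) ^ k"

definition roots_of_minus_one :: "nat \<Rightarrow> nat \<Rightarrow> int set" where
  "roots_of_minus_one p k = {\<xi>. 0 \<le> \<xi> \<and> \<xi> < int p \<and> [\<xi> ^ k + 1 = 0] (mod int p)}"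

(* f is only regarded as a map on X; a point survives all n-fold preimages under this partial map
   iff its whole forward orbit under the total f stays in X. *)
definition julia_set :: "('a \<Rightarrow> 'a) \<Rightarrow> 'a set \<Rightarrow> 'a set" where
  "julia_set f X = (\<Inter>n. (f ^^ n) -` X)"

lemma julia_set_invariant: "f ` julia_set f X \<subseteq> julia_set f X"
proof
  fix y assume "y \<in> f ` julia_set f X"
  then obtain x where y: "y = f x" and x: "\<And>n. (f ^^ n) x \<in> X"
    by (auto simp: julia_set_def)
  have "(f ^^ n) y \<in> X" for n using x[of "Suc n"] by (simp add: y funpow_swap1)
  then show "y \<in> julia_set f X" by (simp add: julia_set_def)
qed

(* Sequence spaces carry the library topology on function types, which is the product topology
   of the discrete topology on nat. *)
definition full_shift_space :: "nat \<Rightarrow> (nat \<Rightarrow> nat) set" where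
  "full_shift_space \<kappa> = {\<omega>. \<forall>n. \<omega> n \<in> {1..\<kappa>}}"

definition left_shift :: "(nat \<Rightarrow> 'a) \<Rightarrow> nat \<Rightarrow> 'a" where
  "left_shift \<omega> = (\<lambda>n. \<omega> (Suc n))"

end

(*
  Write t = \<theta> - 1 and rescale x = -1 + u t. The Ising mapping becomes u |-> ((u - 1 + u t) / (u + 1))^k,
  and the balls of X become the residue discs u = \<eta>_i (mod p). On such a disc the Moebius factor is
  an isometry onto the disc of radius 1/p around \<xi>_i, because the denominator u + 1 and the
  determinant 2 + t are units. The k-th power multiplies distances on that disc by |k|_p and, by
  Banach's fixed point theorem (Newton's iteration with frozen derivative), maps it onto the ball
  of radius |k|_p / p around \<xi>_i^k, which contains -1. As |k|_p > |t|_p and the value group is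
  discrete, this ball contains X. So each ball of X is expanded by the factor |k|_p / |t|_p > 1 over all of X, and
  itineraries give the conjugacy with the full shift.
*)
theory Submission
  imports Defs "HOL-Number_Theory.Residues"
begin

section \<open>Symbolic coding of uniformly expanding maps on a complete metric space\<close>

section \<open>Expanding maps with full branches\<close>

text \<open>Only finitely many coordinates are constrained, each by a set that is open because
  \<open>nat\<close> is discrete. These cylinders are the neighbourhoods used for continuity of the
  inverse coding.\<close>

lemma open_agree_upto: "open {\<omega>' :: nat \<Rightarrow> nat. \<forall>j<n. \<omega>' j = \<omega> j}"
proof -
  have "open ((\<lambda>\<omega>'. \<omega>' j) -` {\<omega> j})" for j
    by (intro open_vimage continuous_on_product_coordinates) (simp add: open_discrete)
  moreover have "{\<omega>' :: nat \<Rightarrow> nat. \<forall>j<n. \<omega>' j = \<omega> j} = (\<Inter>j\<in>{..<n}. (\<lambda>\<omega>'. \<omega>' j) -` {\<omega> j})"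
    by auto
  ultimately show ?thesis by (metis (no_types, lifting) open_INT finite_lessThan)
qed

text \<open>The coding \<open>h\<close> records which ball each iterate visits. Fullness realises
  every finite word, and completeness every infinite one. Expansion forces points that share the
  symbols 0 to n to lie within \<open>d / l ^ n\<close>, which gives injectivity and continuity of
  the inverse. The gap \<open>\<delta>\<close> between different balls makes each symbol locally
  constant, hence \<open>h\<close> continuous.\<close>

lemma expanding_full_branches_conjugate_full_shift:
  fixes f :: "'a::complete_space \<Rightarrow> 'a" and B :: "nat \<Rightarrow> 'a set"
  assumes expand: "l > 1" "\<And>i y z. i \<in> {1..\<kappa>} \<Longrightarrow> y \<in> B i \<Longrightarrow> z \<in> B i \<Longrightarrow> dist (f y) (f z) = l * dist y z"
    and full: "\<And>i j. i \<in> {1..\<kappa>} \<Longrightarrow> j \<in> {1..\<kappa>} \<Longrightarrow> B j \<subseteq> f ` B i"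
    and closed: "\<And>i. i \<in> {1..\<kappa>} \<Longrightarrow> closed (B i)"
    and nonempty: "\<And>i. i \<in> {1..\<kappa>} \<Longrightarrow> B i \<noteq> {}"
    and diam: "\<And>i y z. i \<in> {1..\<kappa>} \<Longrightarrow> y \<in> B i \<Longrightarrow> z \<in> B i \<Longrightarrow> dist y z \<le> d"
    and sep: "\<delta> > 0" "\<And>i j y z. i \<in> {1..\<kappa>} \<Longrightarrow> j \<in> {1..\<kappa>} \<Longrightarrow> y \<in> B i \<Longrightarrow> z \<in> B j \<Longrightarrow>
        dist y z < \<delta> \<Longrightarrow> i = j"
  defines "J \<equiv> julia_set f (\<Union>i\<in>{1..\<kappa>}. B i)"
  shows "\<exists>h h'. homeomorphism J (full_shift_space \<kappa>) h h' \<and> (\<forall>y\<in>J. h (f y) = left_shift (h y))"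
proof -
  define I where "I = {1..\<kappa>}"
  note expand = expand[folded I_def] and full = full[folded I_def] and closed = closed[folded I_def]
    and nonempty = nonempty[folded I_def] and diam = diam[folded I_def] and sep = sep[folded I_def]
  have shift_space_iff: "\<omega> \<in> full_shift_space \<kappa> \<longleftrightarrow> (\<forall>n. \<omega> n \<in> I)" for \<omega>
    unfolding full_shift_space_def I_def by simp
  have J_iff: "y \<in> J \<longleftrightarrow> (\<forall>n. \<exists>i\<in>I. (f ^^ n) y \<in> B i)" for y
    unfolding J_def julia_set_def I_def[symmetric] by auto
  have J_f: "f y \<in> J" if "y \<in> J" for y
    using that unfolding J_def by (rule subsetD[OF julia_set_invariant imageI])
  have unique: "i = j" if "i \<in> I" "j \<in> I" "y \<in> B i" "y \<in> B j" for i j y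
    using sep(2)[of i j y y] sep(1) that by simp
  define h where "h y n = (THE i. i \<in> I \<and> (f ^^ n) y \<in> B i)" for y n
  have h_eq: "h y n = i" if "i \<in> I" "(f ^^ n) y \<in> B i" for y n i
    unfolding h_def using that by (intro the_equality) (auto intro: unique)
  have h_in: "h y n \<in> I" "(f ^^ n) y \<in> B (h y n)" if "y \<in> J" for y n
  proof -
    obtain i where "i \<in> I" "(f ^^ n) y \<in> B i" using \<open>y \<in> J\<close> J_iff by blast
    with h_eq[OF this] show "h y n \<in> I" "(f ^^ n) y \<in> B (h y n)" by simp_all
  qed
  have h_shift: "h (f y) n = h y (Suc n)" for y n
    by (simp add: h_def funpow_swap1)

  \<comment> \<open>Only the symbols before time n are prescribed: the n-th iterates themselves may
    lie anywhere.\<close>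
  have iter_dist: "dist ((f ^^ n) y) ((f ^^ n) z) = l ^ n * dist y z"
    if "\<And>j. j < n \<Longrightarrow> \<omega> j \<in> I \<and> (f ^^ j) y \<in> B (\<omega> j) \<and> (f ^^ j) z \<in> B (\<omega> j)" for y z n \<omega>
    using that
  proof (induction n)
    case (Suc n)
    then have "\<omega> n \<in> I" "(f ^^ n) y \<in> B (\<omega> n)" "(f ^^ n) z \<in> B (\<omega> n)"
      by auto
    moreover have "dist ((f ^^ n) y) ((f ^^ n) z) = l ^ n * dist y z"
      using Suc by simp
    ultimately show ?case using expand(2) by simp
  qed simp
  \<comment> \<open>One more common symbol than in \<open>iter_dist\<close> puts the n-th iterates
    into the same ball, so that their distance is at most \<open>d\<close>.\<close>
  have close: "dist y z \<le> d / l ^ n"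
    if "\<And>j. j \<le> n \<Longrightarrow> \<omega> j \<in> I \<and> (f ^^ j) y \<in> B (\<omega> j) \<and> (f ^^ j) z \<in> B (\<omega> j)" for y z n \<omega>
  proof -
    have "dist ((f ^^ n) y) ((f ^^ n) z) = l ^ n * dist y z"
      by (rule iter_dist[of n \<omega>]) (use that in auto)
    moreover have "dist ((f ^^ n) y) ((f ^^ n) z) \<le> d"
      using that[of n] diam[of "\<omega> n"] by simp
    ultimately have "l ^ n * dist y z \<le> d" by simp
    then show ?thesis using expand(1) by (simp add: field_simps)
  qed
  have small: "\<exists>n. d / l ^ n < e" if "e > 0" for e
  proof -
    obtain n where "d / e < l ^ n" using real_arch_pow[OF expand(1)] by blast
    then show ?thesis using that expand(1) by (intro exI[of _ n]) (simp add: field_simps)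
  qed

  (* S \<omega> n is the cylinder of points following \<omega> for n + 1 steps; the nested cylinders shrink to the
     point with itinerary \<omega>. *)
  define S where "S \<omega> n = {y. \<forall>j\<le>n. (f ^^ j) y \<in> B (\<omega> j)}" for \<omega> n
  have S_nonempty: "S \<omega> n \<noteq> {}" if "\<And>j. \<omega> j \<in> I" for \<omega> n
    using that
  proof (induction n arbitrary: \<omega>)
    case 0
    then show ?case using nonempty by (auto simp: S_def)
  next
    case (Suc n)
    \<comment> \<open>The word is extended at the front: a point following the shifted word is
      pulled back through the full branch of the first symbol.\<close>
    from Suc.IH[of "\<lambda>j. \<omega> (Suc j)"] Suc.prems obtain y where
      y: "\<And>j. j \<le> n \<Longrightarrow> (f ^^ j) y \<in> B (\<omega> (Suc j))" by (auto simp: S_def)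
    have "y \<in> B (\<omega> (Suc 0))" using y[of 0] by simp
    then obtain x where x: "x \<in> B (\<omega> 0)" "f x = y"
      using full[of "\<omega> 0" "\<omega> (Suc 0)"] Suc.prems by auto
    have "(f ^^ j) x \<in> B (\<omega> j)" if "j \<le> Suc n" for j
      using that x y by (cases j) (auto simp: funpow_swap1)
    then show ?case by (auto simp: S_def)
  qed
  have S_closed: "closed (S \<omega> n)" if "\<And>j. \<omega> j \<in> I" for \<omega> n
  proof (induction n)
    case 0
    then show ?case using closed that by (simp add: S_def)
  next
    case (Suc n)
    \<comment> \<open>\<open>f\<close> is controlled only on the balls, but the n+1 symbols
      prescribed by \<open>S \<omega> n\<close> are exactly what makes this iterate scale distances
      by \<open>l ^ Suc n\<close> there.\<close>
    have "continuous_on (S \<omega> n) (f ^^ Suc n)"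
      unfolding continuous_on_iff
    proof (intro ballI allI impI)
      fix x e assume x: "x \<in> S \<omega> n" and e: "e > (0::real)"
      have "dist ((f ^^ Suc n) y) ((f ^^ Suc n) x) < e"
        if y: "y \<in> S \<omega> n" "dist y x < e / l ^ Suc n" for y
      proof -
        have "dist ((f ^^ Suc n) y) ((f ^^ Suc n) x) = l ^ Suc n * dist y x"
          using x y that by (intro iter_dist[of _ \<omega>]) (auto simp: S_def \<open>\<And>j. \<omega> j \<in> I\<close>)
        also have "\<dots> < e" using y(2) expand(1) by (simp add: field_simps)
        finally show ?thesis .
      qed
      then show "\<exists>d>0. \<forall>y\<in>S \<omega> n. dist y x < d \<longrightarrow> dist ((f ^^ Suc n) y) ((f ^^ Suc n) x) < e"
        using e expand(1) by (intro exI[of _ "e / l ^ Suc n"]) auto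
    qed
    then have "closed (S \<omega> n \<inter> (f ^^ Suc n) -` B (\<omega> (Suc n)))"
      using Suc closed that by (intro continuous_closed_preimage) auto
    moreover have "S \<omega> n \<inter> (f ^^ Suc n) -` B (\<omega> (Suc n)) = S \<omega> (Suc n)"
      by (auto simp: S_def le_Suc_eq)
    ultimately show ?case by simp
  qed

  have h_image: "h ` J = full_shift_space \<kappa>"
  proof (intro equalityI subsetI)
    fix \<omega> assume "\<omega> \<in> full_shift_space \<kappa>"
    then have \<omega>: "\<And>j. \<omega> j \<in> I" by (simp add: shift_space_iff)
    \<comment> \<open>Completeness enters here, through Cantor's intersection theorem.\<close>
    obtain y where y: "\<And>n. y \<in> S \<omega> n"
    proof (rule decreasing_closed_nest[of "S \<omega>"])
      show "closed (S \<omega> n)" "S \<omega> n \<noteq> {}" for n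
        using \<omega> by (rule S_closed, rule S_nonempty)
      show "S \<omega> n \<subseteq> S \<omega> m" if "m \<le> n" for m n
        using that by (auto simp: S_def)
      show "\<exists>n. \<forall>x\<in>S \<omega> n. \<forall>y\<in>S \<omega> n. dist x y < e" if e: "e > 0" for e
      proof -
        obtain n where "d / l ^ n < e" using small[OF e] by blast
        then show ?thesis
          by (intro exI[of _ n] ballI) (rule le_less_trans[OF close[of n \<omega>]], use \<omega> in \<open>auto simp: S_def\<close>)
      qed
    qed (rule that)
    then have yB: "(f ^^ n) y \<in> B (\<omega> n)" for n by (auto simp: S_def)
    then have "y \<in> J" using \<omega> by (auto simp: J_iff)
    moreover have "h y = \<omega>" by (rule ext) (rule h_eq[OF \<omega> yB])
    ultimately show "\<omega> \<in> h ` J" by blast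
  qed (use h_in(1) in \<open>auto simp: shift_space_iff\<close>)
  have h_close: "dist y z \<le> d / l ^ n"
    if "y \<in> J" "z \<in> J" "\<And>j. j \<le> n \<Longrightarrow> h z j = h y j" for y z n
  proof (rule close[of n "h y"])
    show "h y j \<in> I \<and> (f ^^ j) y \<in> B (h y j) \<and> (f ^^ j) z \<in> B (h y j)" if "j \<le> n" for j
      using h_in[OF \<open>y \<in> J\<close>, of j] h_in[OF \<open>z \<in> J\<close>, of j] \<open>\<And>j. j \<le> n \<Longrightarrow> h z j = h y j\<close>[OF that]
      by simp
  qed
  have inj: "inj_on h J"
  proof (rule inj_onI, rule ccontr)
    fix y z assume yz: "y \<in> J" "z \<in> J" "h y = h z" "y \<noteq> z"
    then obtain n where "d / l ^ n < dist y z" using small[of "dist y z"] by auto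
    with h_close[OF yz(1,2), of n] yz(3) show False by simp
  qed

  \<comment> \<open>Symbol 0 is constant within distance \<open>\<delta>\<close>. Symbol n+1 of y is
    symbol n of \<open>f y\<close>; within \<open>\<delta>\<close> both points lie on one branch,
    where \<open>f\<close> stretches by l, so a radius e for \<open>f y\<close> becomes e / l for
    y.\<close>
  have h_locally_constant: "\<exists>e>0. \<forall>z\<in>J. dist y z < e \<longrightarrow> h z n = h y n" if "y \<in> J" for y n
    using that
  proof (induction n arbitrary: y)
    case 0
    have "h z 0 = h y 0" if "z \<in> J" "dist y z < \<delta>" for z
      using sep(2)[of "h y 0" "h z 0" y z] h_in[of y 0] h_in[of z 0] 0 that by simp
    then show ?case using sep(1) by blast
  next
    case (Suc n)
    obtain e where e: "e > 0" "\<And>z. z \<in> J \<Longrightarrow> dist (f y) z < e \<Longrightarrow> h z n = h (f y) n"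
      using Suc.IH[OF J_f[OF Suc.prems]] by blast
    have "h z (Suc n) = h y (Suc n)" if z: "z \<in> J" "dist y z < min \<delta> (e / l)" for z
    proof -
      have "h y 0 = h z 0"
        using sep(2)[of "h y 0" "h z 0" y z] h_in[of y 0] h_in[of z 0] Suc.prems z by simp
      then have "dist (f y) (f z) = l * dist y z"
        using h_in[of y 0] h_in[of z 0] Suc.prems z by (intro expand(2)[of "h y 0"]) auto
      also have "\<dots> < e" using z expand(1) by (simp add: field_simps)
      finally show ?thesis using e(2)[OF J_f[OF z(1)]] by (simp add: h_shift)
    qed
    then show ?case using sep(1) e(1) expand(1) by (intro exI[of _ "min \<delta> (e / l)"]) auto
  qed

  have cont_h: "continuous_on J h"
  proof (rule continuous_on_coordinatewise_then_product)
    fix n show "continuous_on J (\<lambda>y. h y n)"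
      unfolding continuous_on_topological
    proof (intro ballI allI impI)
      fix y U assume y: "y \<in> J" "h y n \<in> U"
      then obtain c where c: "c > 0" "\<forall>z\<in>J. dist y z < c \<longrightarrow> h z n = h y n"
        using h_locally_constant by blast
      show "\<exists>A. open A \<and> y \<in> A \<and> (\<forall>z\<in>J. z \<in> A \<longrightarrow> h z n \<in> U)"
      proof (intro exI[of _ "ball y c"] conjI ballI impI)
        show "h z n \<in> U" if "z \<in> J" "z \<in> ball y c" for z
          using c(2) that y(2) by simp
      qed (use c(1) in simp_all)
    qed
  qed
  have cont_inv: "continuous_on (full_shift_space \<kappa>) (inv_into J h)"
    unfolding continuous_on_topological
  proof (intro ballI allI impI)
    fix \<omega> U assume \<omega>: "\<omega> \<in> full_shift_space \<kappa>" and U: "open U" "inv_into J h \<omega> \<in> U"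
    obtain e where e: "e > 0" "ball (inv_into J h \<omega>) e \<subseteq> U"
      using U by (auto simp: open_contains_ball)
    obtain n where n: "d / l ^ n < e" using small[OF e(1)] by blast
    \<comment> \<open>\<open>h_close\<close> compares the symbols 0 to n inclusive, hence the
      cylinder fixes \<open>Suc n\<close> of them.\<close>
    have "inv_into J h \<omega>' \<in> U"
      if \<omega>': "\<omega>' \<in> full_shift_space \<kappa>" "\<omega>' \<in> {\<omega>'. \<forall>j<Suc n. \<omega>' j = \<omega> j}" for \<omega>'
    proof -
      have "h (inv_into J h v) = v \<and> inv_into J h v \<in> J" if "v \<in> full_shift_space \<kappa>" for v
        using that h_image by (metis f_inv_into_f inv_into_into)
      then have "dist (inv_into J h \<omega>) (inv_into J h \<omega>') \<le> d / l ^ n"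
        using \<omega> \<omega>' by (intro h_close) auto
      then have "inv_into J h \<omega>' \<in> ball (inv_into J h \<omega>) e" using n by simp
      then show ?thesis using e(2) by (rule subsetD[rotated])
    qed
    then show "\<exists>A. open A \<and> \<omega> \<in> A \<and> (\<forall>\<omega>'\<in>full_shift_space \<kappa>. \<omega>' \<in> A \<longrightarrow> inv_into J h \<omega>' \<in> U)"
      using open_agree_upto[of "Suc n" \<omega>] by blast
  qed
  have "homeomorphism J (full_shift_space \<kappa>) h (inv_into J h)"
  proof (rule homeomorphismI[OF cont_h cont_inv])
    show "h ` J \<subseteq> full_shift_space \<kappa>" using h_image by simp
    show "inv_into J h ` full_shift_space \<kappa> \<subseteq> J"
      unfolding h_image[symmetric] by (intro image_subsetI inv_into_into)
    show "inv_into J h (h y) = y" if "y \<in> J" for y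
      using inj that by simp
    show "h (inv_into J h \<omega>) = \<omega>" if "\<omega> \<in> full_shift_space \<kappa>" for \<omega>
      using that unfolding h_image[symmetric] by (rule f_inv_into_f)
  qed
  moreover have "\<forall>y\<in>J. h (f y) = left_shift (h y)"
    by (simp add: left_shift_def h_shift fun_eq_iff)
  ultimately show ?thesis by (intro exI conjI)
qed

section \<open>Ultrametric estimates, norms of integers, the discrete value group and the binomial
  remainder\<close>

section \<open>The p-adic norm\<close>

lemma padic_norm_0 [simp]: "padic_norm 0 = 0"
  by simp

lemma padic_norm_1 [simp]: "padic_norm (1 :: 'p::prime_card padic) = 1"
  using padic_norm_mult[of 1 "1 :: 'p padic"] padic_norm_eq_0_iff[of "1 :: 'p padic"] by auto

lemma padic_norm_pos_iff [simp]: "padic_norm x > 0 \<longleftrightarrow> x \<noteq> 0"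
  using padic_norm_nonneg[of x] padic_norm_eq_0_iff[of x] by (metis less_le)

lemma padic_norm_power: "padic_norm (x ^ n) = padic_norm x ^ n"
  by (induction n) (simp_all add: padic_norm_mult)

lemma padic_norm_divide: "padic_norm (x / y) = padic_norm x / padic_norm y"
proof (cases "y = 0")
  case False
  then show ?thesis using padic_norm_mult[of "x / y" y] by (simp add: field_simps)
qed simp

lemma padic_norm_add_le_bound: "padic_norm x \<le> c \<Longrightarrow> padic_norm y \<le> c \<Longrightarrow> padic_norm (x + y) \<le> c"
  using padic_norm_add_le_max[of x y] by linarith

lemma padic_norm_diff_le_bound: "padic_norm x \<le> c \<Longrightarrow> padic_norm y \<le> c \<Longrightarrow> padic_norm (x - y) \<le> c"
  using padic_norm_add_le_bound[of x c "- y"] by simp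

lemma padic_norm_add_less_bound: "padic_norm x < c \<Longrightarrow> padic_norm y < c \<Longrightarrow> padic_norm (x + y) < c"
  using padic_norm_add_le_max[of x y] by linarith

lemma padic_norm_diff_less_bound: "padic_norm x < c \<Longrightarrow> padic_norm y < c \<Longrightarrow> padic_norm (x - y) < c"
  using padic_norm_add_less_bound[of x c "- y"] by simp

lemma padic_norm_sum_le_bound:
  "c \<ge> 0 \<Longrightarrow> (\<And>i. i \<in> A \<Longrightarrow> padic_norm (f i) \<le> c) \<Longrightarrow> padic_norm (sum f A) \<le> c"
  by (induction A rule: infinite_finite_induct) (auto intro: padic_norm_add_le_bound)

text \<open>The isosceles principle: the ultrametric inequality is applied to x = (x - y) + y and to
  y = (y - x) + x.\<close>

lemma padic_norm_eq_of_close: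
  assumes "padic_norm (x - y) < padic_norm y"
  shows "padic_norm x = padic_norm y"
  using assms padic_norm_add_le_max[of "x - y" y] padic_norm_add_le_max[of "y - x" x]
    padic_norm_minus_commute[of x y] by auto

lemma padic_norm_mult_le_bound:
  "padic_norm x \<le> c \<Longrightarrow> padic_norm y \<le> 1 \<Longrightarrow> padic_norm (x * y) \<le> c"
  using mult_mono[of "padic_norm x" c "padic_norm y" 1] order_trans[OF padic_norm_nonneg]
  by (fastforce simp: padic_norm_mult)

lemma padic_norm_units_of_mult:
  assumes "padic_norm (x * y) = 1" "padic_norm x \<le> 1" "padic_norm y \<le> 1"
  shows "padic_norm x = 1" "padic_norm y = 1"
proof -
  have "padic_norm x * padic_norm y \<le> padic_norm x" "padic_norm x * padic_norm y \<le> padic_norm y"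
    using assms mult_left_le[of "padic_norm y" "padic_norm x"]
      mult_right_le_one_le[of "padic_norm y" "padic_norm x"]
    by (auto simp: mult.commute)
  then show "padic_norm x = 1" "padic_norm y = 1" using assms by (auto simp: padic_norm_mult)
qed

lemma padic_norm_of_int:
  assumes "a \<noteq> 0"
  shows "padic_norm (of_int a :: 'p::prime_card padic)
    = 1 / real CARD('p) ^ multiplicity (int CARD('p)) a"
proof -
  have "padic_norm (of_int a :: 'p padic) = padic_abs CARD('p) (of_int a / of_int 1)"
    using padic_norm_of_rat[of "of_int a", where 'p = 'p] by simp
  also have "\<dots> = 1 / real CARD('p) ^ multiplicity (int CARD('p)) a"
    using assms by (subst padic_abs_divide_int[OF prime_card]) (simp_all add: power_int_minus field_simps)
  finally show ?thesis .
qed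

lemma CARD_prime_gt_1: "real CARD('p::prime_card) > 1"
  using prime_gt_1_nat[OF prime_card[where 'a = 'p]] by simp

lemma padic_norm_of_int_le_1: "padic_norm (of_int a :: 'p::prime_card padic) \<le> 1"
  using CARD_prime_gt_1[where 'p = 'p]
  by (cases "a = 0") (simp_all add: padic_norm_of_int)

lemma padic_norm_of_nat_le_1: "padic_norm (of_nat n :: 'p::prime_card padic) \<le> 1"
  using padic_norm_of_int_le_1[of "int n", where 'p = 'p] by simp

lemma padic_norm_of_int_le_iff:
  "padic_norm (of_int a :: 'p::prime_card padic) \<le> 1 / real CARD('p) \<longleftrightarrow> int CARD('p) dvd a"
proof (cases "a = 0")
  case False
  define v where "v = multiplicity (int CARD('p)) a"
  have p: "real CARD('p) > 1" by (rule CARD_prime_gt_1)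
  have "int CARD('p) dvd a \<longleftrightarrow> v \<ge> 1"
    using power_dvd_iff_le_multiplicity[of a "int CARD('p)" 1] False p by (simp add: v_def)
  also have "\<dots> \<longleftrightarrow> real CARD('p) ^ 1 \<le> real CARD('p) ^ v"
    using p by (subst power_increasing_iff) auto
  also have "\<dots> \<longleftrightarrow> padic_norm (of_int a :: 'p padic) \<le> 1 / real CARD('p)"
    using False p by (simp add: padic_norm_of_int v_def[symmetric] field_simps)
  finally show ?thesis by simp
qed simp

lemma padic_norm_of_int_eq_1:
  assumes "\<not> int CARD('p) dvd a"
  shows "padic_norm (of_int a :: 'p::prime_card padic) = 1"
  using assms by (subst padic_norm_of_int) (auto simp: not_dvd_imp_multiplicity_0)

text \<open>The power of p dividing n is at most n itself. This archimedean bound on 1 / |j| later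
  controls the binomial coefficients.\<close>

lemma padic_norm_of_nat_ge:
  assumes "n > 0"
  shows "1 / real n \<le> padic_norm (of_nat n :: 'p::prime_card padic)"
proof -
  define v where "v = multiplicity (int CARD('p)) (int n)"
  have "int CARD('p) ^ v dvd int n" unfolding v_def by (rule multiplicity_dvd)
  then have "int (CARD('p) ^ v) \<le> int n" using assms by (intro zdvd_imp_le) auto
  then have "real CARD('p) ^ v \<le> real n" by (metis of_int_le_iff of_int_of_nat_eq of_nat_power)
  then have "1 / real n \<le> 1 / real CARD('p) ^ v"
    using CARD_prime_gt_1[where 'p = 'p] by (intro divide_left_mono) (auto simp: assms)
  also have "\<dots> = padic_norm (of_nat n :: 'p padic)"
    using padic_norm_of_int[of "int n", where 'p = 'p] assms by (simp add: v_def)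
  finally show ?thesis .
qed

lemma padic_norm_of_CARD: "padic_norm (of_nat CARD('p) :: 'p::prime_card padic) = 1 / real CARD('p)"
proof -
  have "multiplicity (int CARD('p)) (int CARD('p)) = 1"
    using CARD_prime_gt_1[where 'p = 'p] by (intro multiplicity_self) auto
  then show ?thesis using padic_norm_of_int[of "int CARD('p)", where 'p = 'p] by simp
qed

text \<open>A rational closer to x than the norm of x has the same norm by the isosceles principle,
  and norms of nonzero rationals are powers of p by definition.\<close>

lemma padic_norm_discrete:
  assumes "x \<noteq> 0"
  shows "\<exists>n. padic_norm (x :: 'p::prime_card padic) = real CARD('p) powi n"
proof -
  obtain q where q: "dist x (of_rat q) < padic_norm x"
    using padic_rat_dense[of "padic_norm x" x] assms by auto
  then have "padic_norm (of_rat q :: 'p padic) = padic_norm x"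
    by (intro padic_norm_eq_of_close) (simp add: dist_padic_def padic_norm_minus_commute)
  then have "padic_norm x = padic_abs CARD('p) q" by (simp add: padic_norm_of_rat)
  moreover have "q \<noteq> 0" using calculation assms by auto
  ultimately show ?thesis by (auto simp: padic_abs_def)
qed

text \<open>Since norms are integral powers of p, a strict inequality leaves a gap of a whole factor
  p. This converts |t| < |k| into |t| \<le> |k| / p.\<close>

lemma padic_norm_less_imp_le_div:
  fixes x y :: "'p::prime_card padic"
  assumes "padic_norm x < padic_norm y"
  shows "padic_norm x \<le> padic_norm y / real CARD('p)"
proof (cases "x = 0")
  case False
  have p: "real CARD('p) > 1" by (rule CARD_prime_gt_1)
  have "padic_norm y > 0" using assms padic_norm_nonneg[of x] by linarith
  then have "y \<noteq> 0" by auto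
  then obtain m n where mn: "padic_norm x = real CARD('p) powi m" "padic_norm y = real CARD('p) powi n"
    using padic_norm_discrete[of x] padic_norm_discrete[of y] False by auto
  then have "m < n" using assms p
    by (metis linorder_not_less nless_le power_int_increasing)
  then have "real CARD('p) powi m \<le> real CARD('p) powi (n - 1)"
    using p by (intro power_int_increasing) auto
  also have "\<dots> = real CARD('p) powi n / real CARD('p)"
    using p by (simp add: power_int_diff)
  finally show ?thesis by (simp add: mn)
qed simp

text \<open>The sequence decreases from its value 2/3 at j = 2. This is the origin of the constant
  2/3 in the estimates below; that it is less than 1 makes the linear term dominate and the Newton
  iteration contract.\<close>

lemma mult_power_third_le: "real j * (1 / 3) ^ (j - 1) \<le> 2 / 3" if "j \<ge> 2"
  using that
proof (induction j rule: dec_induct)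
  case (step n)
  then obtain i where i: "n = Suc i" by (cases n) auto
  have "real (Suc n) * (1 / 3) ^ (Suc n - 1) = real (Suc n) / 3 * (1 / 3) ^ (n - 1)"
    by (simp add: i)
  also have "\<dots> \<le> real n * (1 / 3) ^ (n - 1)"
    using step.hyps by (intro mult_right_mono) auto
  also have "\<dots> \<le> 2 / 3" by (rule step.IH)
  finally show ?case .
qed simp

text \<open>Put d = a - b and expand (b + d)^k. The identity j (k choose j) = k (k-1 choose j-1)
  yields |k choose j| \<le> |k| / |j| \<le> j |k|, and |d|^(j-1) \<le> 3^(1-j) absorbs the factor j
  for j \<ge> 2. Keeping the factor |k| matters because p may divide k, so the linear term is small
  as well.\<close>

lemma padic_power_diff_linear:
  fixes a b :: "'p::prime_card padic"
  assumes p: "CARD('p) \<ge> 3" and b: "padic_norm b \<le> 1" and ab: "padic_norm (a - b) \<le> 1 / real CARD('p)"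
    and k: "k > 0"
  shows "padic_norm (a ^ k - b ^ k - of_nat k * b ^ (k - 1) * (a - b))
    \<le> 2 / 3 * (padic_norm (of_nat k :: 'p padic) * padic_norm (a - b))"
proof -
  define d where "d = a - b"
  have d: "padic_norm d \<le> 1 / 3"
  proof -
    have "1 / real CARD('p) \<le> 1 / 3" using p by (intro divide_left_mono) auto
    then show ?thesis using ab unfolding d_def by linarith
  qed
  define g where "g j = of_nat (k choose j) * d ^ j * b ^ (k - j)" for j
  have "a ^ k = (\<Sum>j\<le>k. g j)"
    using binomial_ring[of d b k] by (simp add: d_def g_def)
  also have "{..k} = insert 0 (insert 1 {2..k})" using k by auto
  also have "sum g \<dots> = b ^ k + of_nat k * b ^ (k - 1) * d + (\<Sum>j\<in>{2..k}. g j)"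
    by (simp add: g_def)
  finally have *: "a ^ k - b ^ k - of_nat k * b ^ (k - 1) * (a - b) = (\<Sum>j\<in>{2..k}. g j)"
    by (simp add: d_def)
  show ?thesis unfolding *
  proof (rule padic_norm_sum_le_bound)
    fix j assume j: "j \<in> {2..k}"
    let ?K = "padic_norm (of_nat k :: 'p padic)" and ?C = "padic_norm (of_nat (k choose j) :: 'p padic)"
    have "padic_norm (of_nat j * of_nat (k choose j) :: 'p padic)
        = padic_norm (of_nat k * of_nat ((k - 1) choose (j - 1)) :: 'p padic)"
      using times_binomial_minus1_eq[of j k] j by (simp flip: of_nat_mult)
    also have "\<dots> \<le> ?K"
      by (intro padic_norm_mult_le_bound padic_norm_of_nat_le_1) simp
    finally have "padic_norm (of_nat j :: 'p padic) * ?C \<le> ?K" by (simp add: padic_norm_mult)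
    moreover have "1 / real j * ?C \<le> padic_norm (of_nat j :: 'p padic) * ?C"
      using j by (intro mult_right_mono padic_norm_of_nat_ge) auto
    ultimately have "1 / real j * ?C \<le> ?K" by linarith
    then have C: "?C \<le> real j * ?K" using j by (simp add: field_simps)
    have "padic_norm (g j) \<le> padic_norm (of_nat (k choose j) * d ^ j)"
        unfolding g_def by (rule padic_norm_mult_le_bound) (use b in \<open>auto simp: padic_norm_power power_le_one\<close>)
    also have "\<dots> = ?C * padic_norm d ^ (j - 1) * padic_norm d"
      using j power_minus_mult[of j "padic_norm d"] by (simp add: padic_norm_mult padic_norm_power)
    also have "\<dots> \<le> (real j * ?K) * (1 / 3) ^ (j - 1) * padic_norm d"
      using C d by (intro mult_mono power_mono mult_nonneg_nonneg) auto
    also have "\<dots> = (real j * (1 / 3) ^ (j - 1)) * (?K * padic_norm d)" by simp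
    also have "\<dots> \<le> 2 / 3 * (?K * padic_norm d)"
      using j by (intro mult_right_mono mult_power_third_le) auto
    finally show "padic_norm (g j) \<le> 2 / 3 * (?K * padic_norm (a - b))" by (simp add: d_def)
  qed auto
qed

section \<open>Exact scaling and surjectivity of the k-th power on the disc of radius 1/p around a
  unit z\<close>

section \<open>Powers near a p-adic unit\<close>

lemma padic_norm_power_diff_le:
  assumes "padic_norm x \<le> 1" "padic_norm y \<le> 1"
  shows "padic_norm (x ^ n - y ^ n) \<le> padic_norm (x - y)"
proof (induction n)
  case (Suc n)
  have "x ^ Suc n - y ^ Suc n = (x ^ n - y ^ n) * x + (x - y) * y ^ n" by (simp add: algebra_simps)
  also have "padic_norm \<dots> \<le> padic_norm (x - y)"
    using Suc assms
    by (intro padic_norm_add_le_bound padic_norm_mult_le_bound) (auto simp: padic_norm_power power_le_one)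
  finally show ?case .
qed simp

context
  fixes z :: "'p::prime_card padic" and k :: nat
  assumes p: "CARD('p) \<ge> 3" and z: "padic_norm z = 1" and k: "k > 0"
begin

lemma padic_norm_near_unit_le_1:
  assumes "padic_norm (a - z) \<le> 1 / real CARD('p)"
  shows "padic_norm a \<le> 1"
proof -
  have "1 / real CARD('p) \<le> 1" using p by simp
  with assms have "padic_norm (a - z) \<le> 1" by linarith
  then show ?thesis
    using padic_norm_add_le_bound[of "a - z" 1 z] z by simp
qed

text \<open>Freezes the slope at the centre z, the same for all pairs. Replacing
  \<open>b ^ (k - 1)\<close> by \<open>z ^ (k - 1)\<close> costs at most |k| |a - b| |b - z|, and |b
  - z| \<le> 1/p \<le> 2/3.\<close>

lemma padic_power_diff_approx:
  assumes a: "padic_norm (a - z) \<le> 1 / real CARD('p)" and b: "padic_norm (b - z) \<le> 1 / real CARD('p)"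
  shows "padic_norm (a ^ k - b ^ k - of_nat k * z ^ (k - 1) * (a - b))
    \<le> 2 / 3 * (padic_norm (of_nat k :: 'p padic) * padic_norm (a - b))"
proof -
  let ?K = "of_nat k :: 'p padic"
  have third: "1 / real CARD('p) \<le> 2 / 3" using p by (simp add: field_simps)
  have ab: "padic_norm (a - b) \<le> 1 / real CARD('p)"
    using padic_norm_diff_le_bound[OF a b] by simp
  have "padic_norm (b ^ (k - 1) - z ^ (k - 1)) \<le> 2 / 3"
    using padic_norm_power_diff_le[of b z "k - 1"] padic_norm_near_unit_le_1[OF b] z b third by linarith
  then have "padic_norm (?K * (a - b)) * padic_norm (b ^ (k - 1) - z ^ (k - 1))
      \<le> padic_norm (?K * (a - b)) * (2 / 3)"
    by (intro mult_left_mono) auto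
  then have "padic_norm (?K * (a - b) * (b ^ (k - 1) - z ^ (k - 1)))
      \<le> 2 / 3 * (padic_norm ?K * padic_norm (a - b))"
    by (simp add: padic_norm_mult)
  with padic_power_diff_linear[OF p padic_norm_near_unit_le_1[OF b] ab k]
  have "padic_norm ((a ^ k - b ^ k - ?K * b ^ (k - 1) * (a - b)) + ?K * (a - b) * (b ^ (k - 1) - z ^ (k - 1)))
      \<le> 2 / 3 * (padic_norm ?K * padic_norm (a - b))"
    by (rule padic_norm_add_le_bound)
  then show ?thesis by (simp add: algebra_simps)
qed

text \<open>The linear term has norm |k| |a - b| because z is a unit, and the error is strictly
  smaller, so the isosceles principle applies.\<close>

lemma padic_norm_power_diff:
  assumes "padic_norm (a - z) \<le> 1 / real CARD('p)" "padic_norm (b - z) \<le> 1 / real CARD('p)"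
  shows "padic_norm (a ^ k - b ^ k) = padic_norm (of_nat k :: 'p padic) * padic_norm (a - b)"
proof (cases "a = b")
  case False
  have *: "padic_norm (of_nat k * z ^ (k - 1) * (a - b)) = padic_norm (of_nat k :: 'p padic) * padic_norm (a - b)"
    using z by (simp add: padic_norm_mult padic_norm_power)
  have "padic_norm (of_nat k :: 'p padic) * padic_norm (a - b) > 0"
    using False k by (intro mult_pos_pos) simp_all
  then have "padic_norm (a ^ k - b ^ k) = padic_norm (of_nat k * z ^ (k - 1) * (a - b))"
    using padic_power_diff_approx[OF assms] * by (intro padic_norm_eq_of_close) linarith
  then show ?thesis using * by simp
qed simp

text \<open>A fixed point of the Newton map \<open>g\<close> is a k-th root of y. Both a^k and y are
  within |k| / p of z^k, so the correction has norm at most 1/p and \<open>g\<close> preserves the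
  disc. Differences under \<open>g\<close> are the error of the linear approximation divided by the
  slope, hence contract by 2/3.\<close>

lemma padic_power_onto:
  assumes y: "padic_norm (y - z ^ k) \<le> padic_norm (of_nat k :: 'p padic) / real CARD('p)"
  obtains a where "padic_norm (a - z) \<le> 1 / real CARD('p)" "a ^ k = y"
proof -
  let ?K = "padic_norm (of_nat k :: 'p padic)"
  define c where "c = of_nat k * z ^ (k - 1)"
  define g where "g a = a - (a ^ k - y) / c" for a
  have c: "padic_norm c = ?K" using z by (simp add: c_def padic_norm_mult padic_norm_power)
  have K: "?K > 0" using k by simp
  then have c0: "c \<noteq> 0" using c by auto
  let ?S = "cball z (1 / real CARD('p))"
  have "\<exists>!a\<in>?S. g a = a"
  proof (rule Banach_fix)
    show "complete ?S" by (simp add: complete_eq_closed)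
    show "?S \<noteq> {}" by simp
    show "0 \<le> (2 / 3 :: real)" "(2 / 3 :: real) < 1" by simp_all
    show "g ` ?S \<subseteq> ?S"
    proof (intro image_subsetI)
      fix a assume "a \<in> ?S"
      then have a: "padic_norm (a - z) \<le> 1 / real CARD('p)" by (simp add: cball_padic)
      have "padic_norm (a ^ k - z ^ k) \<le> ?K / real CARD('p)"
        using padic_norm_power_diff[OF a] a mult_left_mono[OF a, of ?K] by simp
      from padic_norm_diff_le_bound[OF this y]
      have "padic_norm (a ^ k - y) \<le> ?K / real CARD('p)" by simp
      then have "padic_norm ((a ^ k - y) / c) \<le> 1 / real CARD('p)"
        using K unfolding padic_norm_divide c by (simp add: field_simps)
      from padic_norm_diff_le_bound[OF a this]
      have "padic_norm (a - z - (a ^ k - y) / c) \<le> 1 / real CARD('p)" .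
      then show "g a \<in> ?S" by (simp add: g_def cball_padic algebra_simps)
    qed
    show "dist (g a) (g b) \<le> 2 / 3 * dist a b" if ab: "a \<in> ?S" "b \<in> ?S" for a b
    proof -
      have "g a - g b = - ((a ^ k - b ^ k - c * (a - b)) / c)"
        using c0 by (simp add: g_def field_simps)
      then have "dist (g a) (g b) = padic_norm (a ^ k - b ^ k - c * (a - b)) / ?K"
        by (simp add: dist_padic_def padic_norm_divide c)
      also have "\<dots> \<le> 2 / 3 * (?K * padic_norm (a - b)) / ?K"
        using ab padic_power_diff_approx[of a b] unfolding c_def
        by (intro divide_right_mono) (simp_all only: cball_padic mem_Collect_eq padic_norm_nonneg)
      also have "\<dots> = 2 / 3 * dist a b" using K by (simp add: dist_padic_def)
      finally show ?thesis .
    qed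
  qed
  then obtain a where "a \<in> ?S" "g a = a" by (elim ex1E conjE)
  then show ?thesis using c0 by (intro that[of a]) (auto simp: cball_padic g_def)
qed

end

section \<open>Roots of -1 modulo p, and how close their k-th powers come to -1\<close>

lemma prime_power_cong_self:
  assumes "prime p"
  shows "[a ^ p = a] (mod int p)"
proof (cases "int p dvd a")
  case True
  then have "int p dvd a ^ p"
    using dvd_trans[OF True dvd_power[of p a]] prime_gt_0_nat[OF assms] by simp
  then show ?thesis using True by (simp add: cong_iff_dvd_diff)
next
  case False
  \<comment> \<open>\<open>fermat_theorem\<close> concerns natural numbers, so a is replaced by its
    nonnegative residue.\<close>
  define b where "b = nat (a mod int p)"
  have b: "int b = a mod int p" using prime_gt_0_nat[OF assms] by (simp add: b_def)
  then have ab: "[int b = a] (mod int p)" by (simp add: cong_def)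
  have "\<not> p dvd b"
    using False cong_dvd_iff[OF ab] by simp
  then have "[b ^ (p - 1) = 1] (mod p)" by (rule fermat_theorem[OF assms])
  then have "[b ^ (p - 1) * b = 1 * b] (mod p)" by (rule cong_scalar_right)
  then have "[b ^ p = b] (mod p)"
    using power_minus_mult[of p b] prime_gt_0_nat[OF assms] by simp
  then have "[int (b ^ p) = int b] (mod int p)" by (simp only: cong_int_iff)
  then have "[int b ^ p = int b] (mod int p)" by simp
  then show ?thesis
    using cong_trans[OF cong_sym[OF cong_pow[OF ab]] cong_trans[OF _ ab]] by simp
qed

text \<open>Factors p are stripped from k. If p does not divide k, then |k| = 1 and the claim is the
  hypothesis. If k = p l, Fermat's theorem shows that a^l is also -1 modulo p; the p-th power fixes
  -1, as p is odd, and shrinks the distance to it by |p|, matching |k| = |p| |l|.\<close>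

lemma padic_norm_root_of_minus_one:
  assumes p: "CARD('p::prime_card) \<ge> 3" and k: "k > 0" and "int CARD('p) dvd a ^ k + 1"
  shows "padic_norm (of_int a ^ k + 1 :: 'p padic) \<le> padic_norm (of_nat k :: 'p padic) / real CARD('p)"
  using k assms(3)
proof (induction k rule: less_induct)
  case (less k)
  let ?p = "CARD('p)"
  show ?case
  proof (cases "?p dvd k")
    case False
    then have "padic_norm (of_nat k :: 'p padic) = 1"
      using padic_norm_of_int_eq_1[of "int k", where 'p = 'p] by simp
    moreover have "padic_norm (of_int (a ^ k + 1) :: 'p padic) \<le> 1 / real ?p"
      using less.prems by (subst padic_norm_of_int_le_iff)
    ultimately show ?thesis by simp
  next
    case True
    then obtain l where l: "k = ?p * l" by (rule dvdE)
    have "l > 0" using less.prems(1) l by (cases l) auto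
    then have "1 * l < ?p * l" using p by (intro mult_strict_right_mono) auto
    then have "l < k" by (simp add: l)
    have "[(a ^ l) ^ ?p = a ^ l] (mod int ?p)" by (rule prime_power_cong_self) (rule prime_card)
    then have cong: "[a ^ k + 1 = a ^ l + 1] (mod int ?p)"
      by (simp add: l mult.commute cong_add_rcancel flip: power_mult)
    have dvd: "int ?p dvd a ^ l + 1"
      using less.prems(2) cong_dvd_iff[OF cong] by simp
    have IH: "padic_norm (of_int a ^ l + 1 :: 'p padic) \<le> padic_norm (of_nat l :: 'p padic) / real ?p"
      using less.IH[OF \<open>l < k\<close> \<open>l > 0\<close> dvd] .
    have near: "padic_norm (of_int a ^ l - (- 1) :: 'p padic) \<le> 1 / real ?p"
      using padic_norm_of_int_le_iff[of "a ^ l + 1", where 'p = 'p] dvd by simp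
    have "odd ?p" using prime_odd_nat[OF prime_card[where 'a = 'p]] p by simp
    then have "of_int a ^ k + 1 = (of_int a ^ l) ^ ?p - (- 1 :: 'p padic) ^ ?p"
      by (simp add: l mult.commute flip: power_mult)
    also have "padic_norm \<dots> = padic_norm (of_nat ?p :: 'p padic) * padic_norm (of_int a ^ l - (- 1) :: 'p padic)"
      using p near by (intro padic_norm_power_diff[of "- 1"]) auto
    also have "\<dots> \<le> padic_norm (of_nat ?p :: 'p padic) * (padic_norm (of_nat l :: 'p padic) / real ?p)"
      using IH by (intro mult_left_mono) auto
    also have "\<dots> = padic_norm (of_nat k :: 'p padic) / real ?p"
      by (simp add: l padic_norm_mult)
    finally show ?thesis .
  qed
qed

section \<open>The Ising mapping on a single ball, in the coordinate u with x = -1 + u t\<close>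

section \<open>Branches of the Ising mapping\<close>

definition moebius :: "'a::field \<Rightarrow> 'a \<Rightarrow> 'a" where
  "moebius t u = (u - 1 + u * t) / (u + 1)"

(* u = -1 corresponds to the pole -\<theta> of the Ising mapping; both sides use division by zero there. *)
lemma ising_map_rescaled:
  assumes "t \<noteq> 0"
  shows "ising_map k (1 + t) (- 1 + u * t) = moebius t u ^ k"
proof -
  have "((1 + t) * (- 1 + u * t) + 1) / (- 1 + u * t + (1 + t)) = (t * (u - 1 + u * t)) / (t * (u + 1))"
    by (simp add: algebra_simps)
  also have "\<dots> = moebius t u" using assms by (simp add: moebius_def)
  finally show ?thesis by (simp add: ising_map_def)
qed

context
  fixes t :: "'p::prime_card padic" and \<xi> \<eta> :: int and k :: nat
  assumes p: "CARD('p) \<ge> 3" and k: "k > 0" and t0: "t \<noteq> 0" and t: "padic_norm t \<le> 1 / real CARD('p)"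
    and tk: "padic_norm t < padic_norm (of_nat k :: 'p padic)"
    and root: "int CARD('p) dvd \<xi> ^ k + 1"
    and eta: "int CARD('p) dvd \<eta> * (\<xi> - 1) + \<xi> + 1"
begin

lemma less_1_if_le_inverse_CARD: "r \<le> 1 / real CARD('p) \<Longrightarrow> r < 1"
  using CARD_prime_gt_1[where 'p = 'p] by (smt (verit) divide_less_eq_1_pos)

lemma padic_norm_eq_1_of_close:
  fixes x y :: "'p padic"
  assumes "padic_norm (x - y) \<le> 1 / real CARD('p)" "padic_norm y = 1"
  shows "padic_norm x = 1"
  using padic_norm_eq_of_close[of x y] less_1_if_le_inverse_CARD[OF assms(1)] assms(2) by simp

lemma padic_norm_2: "padic_norm (2 :: 'p padic) = 1"
proof -
  have "\<not> int CARD('p) dvd 2" using p zdvd_imp_le[of "int CARD('p)" 2] by auto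
  then show ?thesis using padic_norm_of_int_eq_1[of 2, where 'p = 'p] by simp
qed

lemma padic_norm_2_plus: "padic_norm (2 + t) = 1"
  using padic_norm_eq_1_of_close[of "2 + t" 2] t padic_norm_2 by simp

lemma padic_norm_root: "padic_norm (of_int \<xi> :: 'p padic) = 1"
proof (rule padic_norm_of_int_eq_1, rule notI)
  assume "int CARD('p) dvd \<xi>"
  then have "int CARD('p) dvd \<xi> ^ k" using dvd_trans[OF _ dvd_power[of k \<xi>]] k by simp
  then have "int CARD('p) dvd 1" using root by (simp add: dvd_add_right_iff)
  then show False using p by simp
qed

lemma padic_norm_centre_congruence:
  "padic_norm (of_int (\<eta> * (\<xi> - 1) + \<xi> + 1) :: 'p padic) \<le> 1 / real CARD('p)"
  using eta by (simp only: padic_norm_of_int_le_iff)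

text \<open>The congruence for \<eta> can be rewritten as (1 - \<xi>) (\<eta> + 1) = 2 modulo p. As
  2 is a unit and both factors are integral, both are units. Hence the residue disc of \<eta> avoids
  the pole u = -1.\<close>

lemma padic_norm_1_minus_root: "padic_norm (1 - of_int \<xi> :: 'p padic) = 1"
  and padic_norm_centre_plus_1: "padic_norm (of_int \<eta> + 1 :: 'p padic) = 1"
proof -
  have *: "padic_norm (1 - of_int \<xi> :: 'p padic) \<le> 1" "padic_norm (of_int \<eta> + 1 :: 'p padic) \<le> 1"
    using padic_norm_of_int_le_1[of "1 - \<xi>", where 'p = 'p]
      padic_norm_of_int_le_1[of "\<eta> + 1", where 'p = 'p] by simp_all
  have "padic_norm ((1 - of_int \<xi>) * (of_int \<eta> + 1) - 2 :: 'p padic)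
      = padic_norm (- of_int (\<eta> * (\<xi> - 1) + \<xi> + 1) :: 'p padic)"
    by (rule arg_cong[where f = padic_norm]) (simp add: algebra_simps)
  also have "\<dots> \<le> 1 / real CARD('p)" using padic_norm_centre_congruence by (simp only: padic_norm_minus)
  finally have "padic_norm ((1 - of_int \<xi>) * (of_int \<eta> + 1) :: 'p padic) = 1"
    using padic_norm_2 by (rule padic_norm_eq_1_of_close)
  then show "padic_norm (1 - of_int \<xi> :: 'p padic) = 1" "padic_norm (of_int \<eta> + 1 :: 'p padic) = 1"
    using padic_norm_units_of_mult * by blast+
qed

lemma padic_norm_near_centre_plus_1:
  assumes "padic_norm (u - of_int \<eta>) \<le> 1 / real CARD('p)"
  shows "padic_norm (u + 1 :: 'p padic) = 1"
  using padic_norm_eq_1_of_close[of "u + 1" "of_int \<eta> + 1"] assms padic_norm_centre_plus_1 by simp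

lemma padic_norm_near_centre_le_1:
  assumes "padic_norm (u - of_int \<eta>) \<le> 1 / real CARD('p)"
  shows "padic_norm (u :: 'p padic) \<le> 1"
  using padic_norm_diff_le_bound[of "u + 1" 1 1] padic_norm_near_centre_plus_1[OF assms] by simp

text \<open>Modulo p the map is u |-> (u - 1) / (u + 1), and the congruence for \<eta> says
  precisely that it sends \<eta> to \<xi>. The numerator below splits into the deviation of u, the
  perturbation by t and the defect of this congruence, each of norm at most 1/p.\<close>

lemma moebius_near:
  assumes u: "padic_norm (u - of_int \<eta>) \<le> 1 / real CARD('p)"
  shows "padic_norm (moebius t u - of_int \<xi>) \<le> 1 / real CARD('p)"
proof -
  have u1: "padic_norm (u + 1) = 1" by (rule padic_norm_near_centre_plus_1[OF u])
  then have "u + 1 \<noteq> 0" by auto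
  then have "moebius t u - of_int \<xi>
      = ((u - of_int \<eta>) * (1 - of_int \<xi>) + t * u - of_int (\<eta> * (\<xi> - 1) + \<xi> + 1)) / (u + 1)"
    by (simp add: moebius_def field_simps)
  also have "padic_norm \<dots> 
      = padic_norm ((u - of_int \<eta>) * (1 - of_int \<xi>) + t * u - of_int (\<eta> * (\<xi> - 1) + \<xi> + 1))"
    by (simp only: padic_norm_divide u1 div_by_1)
  also have "\<dots> \<le> 1 / real CARD('p)"
    using padic_norm_mult_le_bound[OF u eq_refl[OF padic_norm_1_minus_root]]
      padic_norm_mult_le_bound[OF t padic_norm_near_centre_le_1[OF u]] padic_norm_centre_congruence
    by (blast intro: padic_norm_diff_le_bound padic_norm_add_le_bound)
  finally show ?thesis .
qed

lemma moebius_isometry: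
  assumes u: "padic_norm (u - of_int \<eta>) \<le> 1 / real CARD('p)" and v: "padic_norm (v - of_int \<eta>) \<le> 1 / real CARD('p)"
  shows "padic_norm (moebius t u - moebius t v) = padic_norm (u - v)"
proof -
  have nz: "u + 1 \<noteq> 0" "v + 1 \<noteq> 0"
    using padic_norm_near_centre_plus_1[OF u] padic_norm_near_centre_plus_1[OF v] by auto
  \<comment> \<open>\<open>2 + t\<close> is the determinant of the Moebius transformation.\<close>
  then have "moebius t u - moebius t v = (2 + t) * (u - v) / ((u + 1) * (v + 1))"
    by (simp add: moebius_def field_simps)
  then show ?thesis
    using padic_norm_near_centre_plus_1[OF u] padic_norm_near_centre_plus_1[OF v] padic_norm_2_plus
    by (simp add: padic_norm_divide padic_norm_mult)
qed

lemma moebius_onto: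
  assumes z: "padic_norm (z - of_int \<xi>) \<le> 1 / real CARD('p)"
  obtains u where "padic_norm (u - of_int \<eta>) \<le> 1 / real CARD('p)" "moebius t u = z"
proof -
  \<comment> \<open>Solving \<open>moebius t u = z\<close> for u gives u = (1 + z) / w; w is a unit
    because it is close to 1 - \<xi>.\<close>
  define w where "w = 1 + t - z"
  have "padic_norm (w - (1 - of_int \<xi>)) = padic_norm (t - (z - of_int \<xi>))"
    by (rule arg_cong[where f = padic_norm]) (simp add: w_def)
  also have "\<dots> \<le> 1 / real CARD('p)" by (rule padic_norm_diff_le_bound[OF t z])
  finally have w: "padic_norm w = 1"
    using padic_norm_1_minus_root by (rule padic_norm_eq_1_of_close)
  then have w0: "w \<noteq> 0" by auto
  define u where "u = (1 + z) / w"
  have u: "u * w = 1 + z" using w0 by (simp add: u_def)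
  have "(u - of_int \<eta>) * w
      = of_int (\<eta> * (\<xi> - 1) + \<xi> + 1) + (z - of_int \<xi>) * (of_int \<eta> + 1) - t * of_int \<eta>"
    unfolding left_diff_distrib u by (simp add: w_def algebra_simps)
  moreover have "padic_norm \<dots> \<le> 1 / real CARD('p)"
    using padic_norm_mult_le_bound[OF z eq_refl[OF padic_norm_centre_plus_1]]
      padic_norm_mult_le_bound[OF t padic_norm_of_int_le_1[of \<eta>]] padic_norm_centre_congruence
    by (blast intro: padic_norm_diff_le_bound padic_norm_add_le_bound)
  ultimately have "padic_norm ((u - of_int \<eta>) * w) \<le> 1 / real CARD('p)" by (simp only:)
  then have near: "padic_norm (u - of_int \<eta>) \<le> 1 / real CARD('p)" by (simp only: padic_norm_mult w mult_1_right)
  then have "u + 1 \<noteq> 0" using padic_norm_near_centre_plus_1 by fastforce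
  moreover have "u - 1 + u * t = z * (u + 1)" using u by (simp add: w_def algebra_simps)
  ultimately have "moebius t u = z" by (simp add: moebius_def)
  with near show ?thesis by (rule that)
qed

abbreviation (input) "branch_ball \<equiv> cball (- 1 + of_int \<eta> * t) (padic_norm t / real CARD('p))"

lemma mem_branch_iff: "- 1 + u * t \<in> branch_ball \<longleftrightarrow> padic_norm (u - of_int \<eta>) \<le> 1 / real CARD('p)"
proof -
  have "- 1 + u * t - (- 1 + of_int \<eta> * t) = t * (u - of_int \<eta>)" by (simp add: algebra_simps)
  then have "- 1 + u * t \<in> branch_ball \<longleftrightarrow> padic_norm t * padic_norm (u - of_int \<eta>) \<le> padic_norm t * (1 / real CARD('p))"
    by (simp add: cball_padic padic_norm_mult)
  also have "\<dots> \<longleftrightarrow> padic_norm (u - of_int \<eta>) \<le> 1 / real CARD('p)"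
    using t0 by (intro mult_le_cancel_left_pos) simp
  finally show ?thesis .
qed

lemma branch_coordinate:
  assumes "x \<in> branch_ball"
  obtains u where "x = - 1 + u * t" "padic_norm (u - of_int \<eta>) \<le> 1 / real CARD('p)"
proof -
  have x: "x = - 1 + ((x + 1) / t) * t" using t0 by simp
  with assms mem_branch_iff[of "(x + 1) / t"] that show ?thesis by metis
qed

text \<open>Passing from x to u divides distances by |t|, the Moebius factor preserves them and the
  power multiplies them by |k|. The image is again measured in the original coordinate, so |t|
  occurs only once.\<close>

lemma ising_branch_expanding:
  assumes "x \<in> branch_ball" "y \<in> branch_ball"
  shows "dist (ising_map k (1 + t) x) (ising_map k (1 + t) y)
    = padic_norm (of_nat k :: 'p padic) / padic_norm t * dist x y"
proof -
  obtain u v where u: "x = - 1 + u * t" "padic_norm (u - of_int \<eta>) \<le> 1 / real CARD('p)"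
    and v: "y = - 1 + v * t" "padic_norm (v - of_int \<eta>) \<le> 1 / real CARD('p)"
    using assms branch_coordinate by metis
  have "x - y = (u - v) * t" by (simp add: u v algebra_simps)
  then have d: "dist x y = padic_norm (u - v) * padic_norm t" by (simp add: dist_padic_def padic_norm_mult)
  have "dist (ising_map k (1 + t) x) (ising_map k (1 + t) y)
      = padic_norm (moebius t u ^ k - moebius t v ^ k)"
    by (simp only: u v ising_map_rescaled[OF t0] dist_padic_def)
  also have "\<dots> = padic_norm (of_nat k :: 'p padic) * padic_norm (u - v)"
    using padic_norm_power_diff[OF p padic_norm_root k moebius_near[OF u(2)] moebius_near[OF v(2)]]
      moebius_isometry[OF u(2) v(2)] by simp
  finally show ?thesis using d t0 by simp
qed

text \<open>The ball on the left contains every branch ball by \<open>branch_subset\<close>, so it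
  serves as a common target. Its points are within |t| \<le> |k| / p of -1, and so is \<xi>^k within
  |k| / p; hence they lie in the image of the k-th power on the disc around \<xi>, which the Moebius
  factor covers.\<close>

lemma ising_branch_full: "cball (- 1) (padic_norm t) \<subseteq> ising_map k (1 + t) ` branch_ball"
proof
  fix y :: "'p padic" assume "y \<in> cball (- 1) (padic_norm t)"
  then have "padic_norm (y + 1) \<le> padic_norm t" by (simp add: cball_padic)
  also have "\<dots> \<le> padic_norm (of_nat k :: 'p padic) / real CARD('p)"
    by (rule padic_norm_less_imp_le_div[OF tk])
  finally have "padic_norm ((y + 1) - (of_int \<xi> ^ k + 1)) \<le> padic_norm (of_nat k :: 'p padic) / real CARD('p)"
    using padic_norm_root_of_minus_one[OF p k root] by (rule padic_norm_diff_le_bound)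
  then have "padic_norm (y - of_int \<xi> ^ k) \<le> padic_norm (of_nat k :: 'p padic) / real CARD('p)" by simp
  then obtain z where z: "padic_norm (z - of_int \<xi>) \<le> 1 / real CARD('p)" "z ^ k = y"
    by (rule padic_power_onto[OF p padic_norm_root k])
  obtain u where u: "padic_norm (u - of_int \<eta>) \<le> 1 / real CARD('p)" "moebius t u = z"
    using moebius_onto[OF z(1)] .
  have "- 1 + u * t \<in> branch_ball" using u(1) by (simp only: mem_branch_iff)
  moreover have "ising_map k (1 + t) (- 1 + u * t) = y"
    by (simp only: ising_map_rescaled[OF t0] u z)
  ultimately show "y \<in> ising_map k (1 + t) ` branch_ball" by blast
qed

lemma branch_subset: "branch_ball \<subseteq> cball (- 1) (padic_norm t)"
proof
  fix x assume "x \<in> branch_ball"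
  then obtain u where u: "x = - 1 + u * t" "padic_norm (u - of_int \<eta>) \<le> 1 / real CARD('p)" by (rule branch_coordinate)
  have "padic_norm (t * u) \<le> padic_norm t"
    using padic_norm_near_centre_le_1[OF u(2)] by (intro padic_norm_mult_le_bound) simp
  then show "x \<in> cball (- 1) (padic_norm t)" by (simp add: u(1) cball_padic mult.commute)
qed

end

text \<open>Subtracting the two congruences and a multiple of \<eta> - \<eta>' leaves (\<eta> + 1)
  (\<xi> - \<xi>'), whose first factor is invertible modulo P. Thus different roots have incongruent
  centres, and their balls are separated.\<close>

lemma roots_cong_of_centres_cong:
  fixes P :: int
  assumes "prime P" "P dvd \<eta> * (\<xi> - 1) + \<xi> + 1" "P dvd \<eta>' * (\<xi>' - 1) + \<xi>' + 1"
    and "P dvd \<eta> - \<eta>'" "\<not> P dvd \<eta> + 1"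
  shows "[\<xi> = \<xi>'] (mod P)"
proof -
  have "P dvd (\<eta> * (\<xi> - 1) + \<xi> + 1) - (\<eta>' * (\<xi>' - 1) + \<xi>' + 1)"
    using assms(2,3) by (rule dvd_diff)
  then have "P dvd (\<eta> * (\<xi> - 1) + \<xi> + 1) - (\<eta>' * (\<xi>' - 1) + \<xi>' + 1) - (\<eta> - \<eta>') * (\<xi>' - 1)"
    using dvd_mult2[OF assms(4)] by (rule dvd_diff)
  also have "(\<eta> * (\<xi> - 1) + \<xi> + 1) - (\<eta>' * (\<xi>' - 1) + \<xi>' + 1) - (\<eta> - \<eta>') * (\<xi>' - 1)
      = (\<eta> + 1) * (\<xi> - \<xi>')"
    by (simp add: algebra_simps)
  finally have "P dvd (\<eta> + 1) * (\<xi> - \<xi>')" .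
  then show ?thesis using assms by (simp add: prime_dvd_mult_iff cong_iff_dvd_diff)
qed

section \<open>Assembly: separation of the balls and application of the coding theorem\<close>

theorem corollary1p2:
  fixes \<theta> :: "'p::prime_card padic"
    and p k m s \<kappa> :: nat
    and \<xi> \<eta> :: "nat \<Rightarrow> int"
    and x :: "nat \<Rightarrow> 'p padic"
    and X :: "'p padic set"
  assumes "p = CARD('p)" and "p \<ge> 3"
    and "m \<ge> 1" and "k = m * p ^ s"
    and "even ((p - 1) div gcd m (p - 1))"
    and "\<theta> \<in> padic_E" and "\<theta> \<noteq> 1"
    and "\<kappa> = card (roots_of_minus_one p k)" and "\<kappa> \<ge> 2"
    and "bij_betw \<xi> {1..\<kappa>} (roots_of_minus_one p k)"
    and "\<And>i. i \<in> {1..\<kappa>} \<Longrightarrow> \<not> [\<xi> i + 1 = 0] (mod int p) \<Longrightarrow>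
           [\<eta> i * (\<xi> i - 1) + \<xi> i + 1 = 0] (mod int p)"
    and "\<And>i. i \<in> {1..\<kappa>} \<Longrightarrow>
           x i = (if [\<xi> i + 1 = 0] (mod int p) then - 1 else - 1 + of_int (\<eta> i) * (\<theta> - 1))"
    and "X = (\<Union>i\<in>{1..\<kappa>}. cball (x i) (padic_norm (of_nat p * (\<theta> - 1))))"
    and "padic_norm (of_nat k :: 'p padic) > padic_norm (\<theta> - 1)"
  shows "\<exists>h h'. homeomorphism (julia_set (ising_map k \<theta>) X) (full_shift_space \<kappa>) h h' \<and>
           (\<forall>y\<in>julia_set (ising_map k \<theta>) X. h (ising_map k \<theta> y) = left_shift (h y))"
proof -
  define t where "t = \<theta> - 1"
  (* When \<xi> i = -1 (mod p) nothing is known about \<eta> i; the centre -1 of the ball corresponds to 0,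
     which solves the defining congruence of \<eta> i in that case. *)
  define \<zeta> where "\<zeta> i = (if [\<xi> i + 1 = 0] (mod int p) then 0 else \<eta> i)" for i
  have P: "p = CARD('p)" "CARD('p) \<ge> 3" using assms(1,2) by simp_all
  have "prime (int p)" using prime_card[where 'a = 'p] P(1) by simp
  have k: "k > 0" using assms(2,3,4) by simp
  have \<theta>: "\<theta> = 1 + t" and t0: "t \<noteq> 0" using assms(7) by (simp_all add: t_def)
  have t: "padic_norm t \<le> 1 / real CARD('p)" using assms(6) by (simp add: padic_E_def t_def)
  have tk: "padic_norm t < padic_norm (of_nat k :: 'p padic)" using assms(14) by (simp add: t_def)
  have radius: "padic_norm (of_nat p * (\<theta> - 1)) = padic_norm t / real CARD('p)"
    by (simp add: P(1) t_def padic_norm_mult padic_norm_of_CARD)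
  define B where "B i = cball (- 1 + of_int (\<zeta> i) * t) (padic_norm t / real CARD('p))" for i
  have X: "X = (\<Union>i\<in>{1..\<kappa>}. B i)"
    unfolding assms(13) B_def radius
    by (intro SUP_cong refl) (simp add: assms(12) \<zeta>_def t_def)
  have \<xi>: "\<xi> i \<in> roots_of_minus_one p k" if "i \<in> {1..\<kappa>}" for i
    using assms(10) that by (rule bij_betw_apply)
  have root: "int CARD('p) dvd \<xi> i ^ k + 1" if "i \<in> {1..\<kappa>}" for i
    using \<xi>[OF that] by (simp add: roots_of_minus_one_def cong_0_iff P(1))
  have eta: "int CARD('p) dvd \<zeta> i * (\<xi> i - 1) + \<xi> i + 1" if "i \<in> {1..\<kappa>}" for i
    using assms(11)[OF that] unfolding \<zeta>_def P(1) by (auto simp: cong_0_iff)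
  note base = P(2) k t0 t tk
  have subset: "B i \<subseteq> cball (- 1) (padic_norm t)" if "i \<in> {1..\<kappa>}" for i
    unfolding B_def by (rule branch_subset[OF base root[OF that] eta[OF that]])
  have sep: "i = j" if ij: "i \<in> {1..\<kappa>}" "j \<in> {1..\<kappa>}" and yz: "y \<in> B i" "z \<in> B j" "dist y z < padic_norm t"
    for i j y z
  proof -
    have less: "padic_norm t / real CARD('p) < padic_norm t"
      using t0 P(2) by (simp add: divide_less_eq)
    let ?x = "\<lambda>i. - 1 + of_int (\<zeta> i) * t"
    have 1: "padic_norm (y - ?x i) < padic_norm t" and 2: "padic_norm (z - ?x j) < padic_norm t"
      using yz(1,2) less unfolding B_def cball_padic mem_Collect_eq by linarith+
    \<comment> \<open>The sum telescopes to the difference of the centres, which is t times the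
      integer \<open>\<zeta> i - \<zeta> j\<close>. A norm below |t| therefore forces p to divide
      this integer.\<close>
    have "padic_norm (((y - z) - (y - ?x i)) + (z - ?x j)) < padic_norm t"
      using padic_norm_add_less_bound[OF padic_norm_diff_less_bound[OF yz(3)[unfolded dist_padic_def] 1] 2] .
    also have "((y - z) - (y - ?x i)) + (z - ?x j) = t * of_int (\<zeta> i - \<zeta> j)"
      by (simp add: algebra_simps)
    finally have "padic_norm (of_int (\<zeta> i - \<zeta> j) :: 'p padic) < 1"
      using t0 by (simp add: padic_norm_mult)
    then have "int p dvd \<zeta> i - \<zeta> j"
      using padic_norm_of_int_eq_1[of "\<zeta> i - \<zeta> j", where 'p = 'p] P(1) by fastforce
    moreover have "\<not> int p dvd \<zeta> i + 1"
    proof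
      assume "int p dvd \<zeta> i + 1"
      then have "padic_norm (of_int (\<zeta> i + 1) :: 'p padic) \<le> 1 / real CARD('p)"
        by (simp only: padic_norm_of_int_le_iff P(1))
      then show False using padic_norm_centre_plus_1[OF base root[OF ij(1)] eta[OF ij(1)]] P(2) by simp
    qed
    ultimately have "[\<xi> i = \<xi> j] (mod int p)"
      using roots_cong_of_centres_cong[OF \<open>prime (int p)\<close>] eta[OF ij(1)] eta[OF ij(2)] P(1) by metis
    \<comment> \<open>Both roots are representatives in the range from 0 to p - 1, so congruence is
      equality.\<close>
    then have "\<xi> i = \<xi> j"
      using \<xi>[OF ij(1)] \<xi>[OF ij(2)] by (auto simp: roots_of_minus_one_def intro: cong_less_imp_eq_int)
    then show "i = j" using ij assms(10) by (auto simp: bij_betw_def dest: inj_onD)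
  qed
  show ?thesis unfolding X \<theta>
  proof (rule expanding_full_branches_conjugate_full_shift[where l = "padic_norm (of_nat k :: 'p padic) / padic_norm t"
        and \<delta> = "padic_norm t" and d = "2 * padic_norm t"])
    show "padic_norm (of_nat k :: 'p padic) / padic_norm t > 1" using tk t0 by simp
    show "padic_norm t > 0" using t0 by simp
    show "closed (B i)" "B i \<noteq> {}" for i by (simp_all add: B_def not_less)
    \<comment> \<open>Any uniform bound on the diameters will do; this one comes from the triangle
      inequality through the common centre -1.\<close>
    show "dist y z \<le> 2 * padic_norm t" if "i \<in> {1..\<kappa>}" "y \<in> B i" "z \<in> B i" for i y z
      using subsetD[OF subset[OF that(1)] that(2)] subsetD[OF subset[OF that(1)] that(3)]
        dist_triangle3[of y z "- 1"] unfolding mem_cball by linarith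
    show "dist (ising_map k (1 + t) y) (ising_map k (1 + t) z)
        = padic_norm (of_nat k :: 'p padic) / padic_norm t * dist y z"
      if "i \<in> {1..\<kappa>}" "y \<in> B i" "z \<in> B i" for i y z
      using ising_branch_expanding[OF base root[OF that(1)] eta[OF that(1)]] that unfolding B_def by blast
    show "B j \<subseteq> ising_map k (1 + t) ` B i" if "i \<in> {1..\<kappa>}" "j \<in> {1..\<kappa>}" for i j
      using subset[OF that(2)] ising_branch_full[OF base root[OF that(1)] eta[OF that(1)]]
      unfolding B_def by (rule subset_trans)
  qed (rule sep)
qed

end
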